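(* Let $\mathscr{S}$ be a basis of shapes in $\mathbb{R}^n$. Assume that $\mathscr{S}$ satisfies the density condition, and that there is a constant $c$ such that for every rearrangeable $g\in\mathrm{BMO}_{\mathscr{S}}(\mathbb{R}^n)$ one has $g^*\in\mathrm{BMO}(\mathbb{R}_+)$ with $\|g^*\|_{\mathrm{BMO}}\le c\,\|g\|_{\mathrm{BMO}_{\mathscr{S}}}$. Let $f_k$, $k\in\mathbb{N}$, and $f$ be rearrangeable functions in $\mathrm{BMO}_{\mathscr{S}}(\mathbb{R}^n)$, and write $L:=\inf_{s>0} f^*(s)$. If $f\in\mathrm{VMO}_{\mathscr{S}}(\mathbb{R}^n)$, $f_k\to f$ in $\mathrm{BMO}_{\mathscr{S}}(\mathbb{R}^n)$, $0\le f_k\uparrow f$ pointwise (i.e. the $f_k$ are nonnegative and increase pointwise to $f$), and $(L-f_k^* )_+\to0$ in $\mathrm{BMO}(\mathbb{R}_+)$, then the symmetric decreasing rearrangements satisfy $Sf_k\to Sf$ in $\mathrm{BMO}(\mathbb{R}^n)$.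
   Context: $|\cdot|$ is Lebesgue measure (or the Euclidean norm of a point), $y_+=\max(y,0)$, $\mathbb{R}_+=(0,\infty)$. A basis of shapes in $\mathbb{R}^n$ is a collection $\mathscr{S}$ of open sets $S\subset\mathbb{R}^n$ with $0<|S|<\infty$ that covers $\mathbb{R}^n$. For $f\in L^1(S)$ real-valued, $f_S=\frac1{|S|}\int_S f$ and $\mathcal{O}(f,S)=\frac1{|S|}\int_S|f-f_S|$. $\mathrm{BMO}_{\mathscr{S}}(\mathbb{R}^n)$ is the set of real-valued $f$ with $f\in L^1(S)$ for all $S\in\mathscr{S}$ and $\|f\|_{\mathrm{BMO}_{\mathscr{S}}}:=\sup_{S\in\mathscr{S}}\mathcal{O}(f,S)<\infty$ (a seminorm; functions are not identified modulo constants). $\mathrm{VMO}_{\mathscr{S}}(\mathbb{R}^n)$ is the set of $f\in\mathrm{BMO}_{\mathscr{S}}(\mathbb{R}^n)$ with $\lim_{\delta\to0^+}\sup_{S\in\mathscr{S},\,|S|\le\delta}\mathcal{O}(f,S)=0$. Convergence in a BMO space means convergence in its seminorm. $\mathrm{BMO}(\mathbb{R}^n)$ (without subscript) is the BMO space for the basis of all finite open cubes with sides parallel to the axes, and $\mathrm{BMO}(\mathbb{R}_+)$ is the BMO space for the basis of all finite open intervals contained in $\mathbb{R}_+$ (including intervals $(0,b)$). Density condition on $\mathscr{S}$: there exists $q\in(0,\frac14]$ such that for every measurable $E\subset\mathbb{R}^n$ with $|E|>0$ and $|\mathbb{R}^n\setminus E|>0$, $$\limsup_{S\in\mathscr{S},\,|S|\to0}\rho(E,S)(1-\rho(E,S))\ge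 q,\qquad \rho(E,S)=\frac{|E\cap S|}{|S|}$$ (in particular, shapes of arbitrarily small measure exist). For measurable $f$ on $\mathbb{R}^n$, $\mu_f(\alpha)=|\{x\in\mathbb{R}^n:|f(x)|>\alpha\}|$ for $\alpha\ge0$; $f$ is rearrangeable if $\mu_f(\alpha)\to0$ as $\alpha\to\infty$; the decreasing rearrangement is $f^*(s)=|\{\alpha\ge0:\mu_f(\alpha)>s\}|$ for $s>0$; and the symmetric decreasing rearrangement is $Sf(x)=f^*(\omega_n|x|^n)$ for $x\in\mathbb{R}^n\setminus\{0\}$, where $\omega_n$ is the volume of the unit ball in $\mathbb{R}^n$. *)

theory Defs
  imports "HOL-Analysis.Analysis"
begin

definition basis_of_shapes :: "'a::euclidean_space set set \<Rightarrow> bool" where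
  "basis_of_shapes \<S> \<longleftrightarrow>
     (\<forall>S\<in>\<S>. open S \<and> 0 < emeasure lebesgue S \<and> emeasure lebesgue S < \<infinity>) \<and> \<Union>\<S> = UNIV"

definition mean_value :: "('a::euclidean_space \<Rightarrow> real) \<Rightarrow> 'a set \<Rightarrow> real" where
  "mean_value f S = (LINT x:S|lebesgue. f x) / measure lebesgue S"

definition mean_osc :: "('a::euclidean_space \<Rightarrow> real) \<Rightarrow> 'a set \<Rightarrow> real" where
  "mean_osc f S = (LINT x:S|lebesgue. \<bar>f x - mean_value f S\<bar>) / measure lebesgue S"

text \<open>The following notions are stated for an arbitrary family of sets, so that they apply both to
  bases of shapes in \<open>\<real>\<^sup>n\<close> and to families covering only a part of the space. Functions are total;
  their values outside the union of the family are irrelevant. The value of \<open>bmo_seminorm\<close> is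
  meaningful only for functions that are integrable on every member of the family, which is
  why membership in \<open>BMO\<close> is also part of convergence below.\<close>

definition bmo_seminorm :: "'a::euclidean_space set set \<Rightarrow> ('a \<Rightarrow> real) \<Rightarrow> ennreal" where
  "bmo_seminorm \<S> f = (SUP S\<in>\<S>. ennreal (mean_osc f S))"

definition BMO :: "'a::euclidean_space set set \<Rightarrow> ('a \<Rightarrow> real) set" where
  "BMO \<S> = {f. (\<forall>S\<in>\<S>. set_integrable lebesgue S f) \<and> bmo_seminorm \<S> f < \<infinity>}"

definition VMO :: "'a::euclidean_space set set \<Rightarrow> ('a \<Rightarrow> real) set" where
  "VMO \<S> = {f \<in> BMO \<S>.
     ((\<lambda>\<delta>. SUP S\<in>{S\<in>\<S>. measure lebesgue S \<le> \<delta>}. ennreal (mean_osc f S)) \<longlongrightarrow> 0) (at_right 0)}"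

definition converges_in_BMO ::
    "'a::euclidean_space set set \<Rightarrow> (nat \<Rightarrow> 'a \<Rightarrow> real) \<Rightarrow> ('a \<Rightarrow> real) \<Rightarrow> bool" where
  "converges_in_BMO \<S> F f \<longleftrightarrow> (\<forall>k. F k \<in> BMO \<S>) \<and> f \<in> BMO \<S> \<and>
     (\<lambda>k. bmo_seminorm \<S> (\<lambda>x. F k x - f x)) \<longlonglongrightarrow> 0"

definition cubes :: "(real ^ 'n) set set" where
  "cubes = {box a (a + vec l) |a l. 0 < l}"

definition pos_intervals :: "real set set" where
  "pos_intervals = {{a<..<b} |a b. 0 \<le> a \<and> a < b}"

definition shape_density :: "'a::euclidean_space set \<Rightarrow> 'a set \<Rightarrow> real" where
  "shape_density E S = measure lebesgue (E \<inter> S) / measure lebesgue S"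

text \<open>The filter of shapes \<open>S \<in> \<S>\<close> with \<open>|S| \<rightarrow> 0\<close>. If there are no shapes of arbitrarily small
  measure, it is the trivial filter, along which an upper limit in \<open>ereal\<close> is \<open>-\<infinity>\<close>; hence the
  density condition implies the existence of such shapes.\<close>

definition shrinking :: "'a::euclidean_space set set \<Rightarrow> 'a set filter" where
  "shrinking \<S> = inf (filtercomap (measure lebesgue) (at_right 0)) (principal \<S>)"

definition density_condition :: "'a::euclidean_space set set \<Rightarrow> bool" where
  "density_condition \<S> \<longleftrightarrow>
     (\<exists>q::real. 0 < q \<and> q \<le> 1/4 \<and>
        (\<forall>E\<in>sets lebesgue. 0 < emeasure lebesgue E \<and> 0 < emeasure lebesgue (- E) \<longrightarrow>
           Limsup (shrinking \<S>) (\<lambda>S. ereal (shape_density E S * (1 - shape_density E S))) \<ge> ereal q))"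

definition distribution_fun :: "('a::euclidean_space \<Rightarrow> real) \<Rightarrow> real \<Rightarrow> ennreal" where
  "distribution_fun f \<alpha> = emeasure lebesgue {x. \<bar>f x\<bar> > \<alpha>}"

definition rearrangeable :: "('a::euclidean_space \<Rightarrow> real) \<Rightarrow> bool" where
  "rearrangeable f \<longleftrightarrow> f \<in> borel_measurable lebesgue \<and> (distribution_fun f \<longlongrightarrow> 0) at_top"

text \<open>For rearrangeable \<open>f\<close> and \<open>s > 0\<close> the set below is bounded, so that its measure is finite.
  Only the values at \<open>s > 0\<close>, respectively at \<open>x \<noteq> 0\<close> for the symmetric rearrangement, are
  meaningful.\<close>

definition decr_rearr :: "('a::euclidean_space \<Rightarrow> real) \<Rightarrow> real \<Rightarrow> real" where
  "decr_rearr f s = measure lebesgue {\<alpha>. 0 \<le> \<alpha> \<and> distribution_fun f \<alpha> > ennreal s}"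

definition symm_rearr :: "(real ^ 'n \<Rightarrow> real) \<Rightarrow> real ^ 'n \<Rightarrow> real" where
  "symm_rearr f x =
     decr_rearr f (measure lebesgue (ball (0 :: real ^ 'n) 1) * norm x ^ CARD('n))"

end

theory Submission
  imports Defs
begin

text \<open>
  Split a level as \<open>y = max (y - t) 0 + max L (min t y) - max (L - y) 0\<close> and apply this to \<open>F\<^sub>k\<^sup>*\<close> and \<open>f\<^sup>*\<close>.
  The parts above \<open>t\<close> have small seminorm for large \<open>t\<close>, since rearrangement commutes with truncation, is
  bounded, and \<open>f\<close> has vanishing mean oscillation. The density condition forbids gaps in the range of \<open>f\<close>,
  so that \<open>f\<^sup>*\<close> takes values in every subinterval of its range above \<open>L\<close>; monotonicity in \<open>s\<close> then turns
  pointwise into uniform convergence of the middle parts. The parts below \<open>L\<close> are handled by hypothesis.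
  To pass from the half line to cubes, replace a cube by the part of the cone over it in a shell
  around the origin of comparable thickness, where radial functions are averaged exactly as on an interval.
\<close>

subsection \<open>Mean oscillation\<close>

text \<open>Rearrangement is not linear: the assumed bound controls the seminorm of
  \<open>g\<^sup>*\<close> but gives no bound for \<open>g\<^sup>* - h\<^sup>*\<close>, even when
  \<open>g - h\<close> is small. It can enter only where both rearrangements are small separately,
  which cutting off at a high level \<open>t\<close> achieves; one \<open>t\<close> serves all
  \<open>k\<close> because \<open>F k \<le> f\<close> and its choice depends on \<open>f\<close>
  alone. Between \<open>L\<close> and \<open>t\<close> the comparison is in the supremum norm. There
  \<open>F\<^sub>k\<^sup>* \<le> f\<^sup>*\<close> holds by monotonicity, so just a lower bound is
  missing, and finitely many levels suffice because the band is bounded. This has to stop at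
  \<open>L\<close>, since each \<open>F\<^sub>k\<^sup>*\<close> may drop below \<open>L\<close> for
  large arguments while \<open>f\<^sup>*\<close> never does. A gap in the range of
  \<open>f\<^sup>*\<close> would be a jump, whose location for \<open>F\<^sub>k\<^sup>*\<close>
  could move with \<open>k\<close> and destroy uniformity. But such a gap splits space into two sets
  on which the values of \<open>f\<close> differ by a fixed amount, and the density condition finds
  arbitrarily small shapes that see both.\<close>

lemma set_integrable_const_lmeasurable:
  fixes k :: real
  assumes "S \<in> lmeasurable"
  shows "set_integrable lebesgue S (\<lambda>x. k)"
  using assms by (simp add: set_integrable_def lmeasurable_iff_integrable)

text \<open>The triangle inequality passes from \<open>c\<close> to the mean, whose distance from
  \<open>c\<close> is at most the mean of \<open>\<bar>f - c\<bar>\<close>. The price is the factor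
  2, which later estimates with a freely chosen constant inherit.\<close>

lemma mean_osc_le:
  assumes f: "set_integrable lebesgue S f" and S: "S \<in> lmeasurable"
  shows "mean_osc f S \<le> 2 * (LINT x:S|lebesgue. \<bar>f x - c\<bar>) / measure lebesgue S"
proof (cases "measure lebesgue S = 0")
  case True
  then show ?thesis by (simp add: mean_osc_def)
next
  case False
  then have pos: "0 < measure lebesgue S"
    by (simp add: zero_less_measure_iff)
  have const: "set_integrable lebesgue S (\<lambda>x. k)" for k :: real
    by (rule set_integrable_const_lmeasurable[OF S])
  have int: "set_integrable lebesgue S (\<lambda>x. f x - k)" for k
    by (rule set_integral_diff(1)[OF f const])
  have int_abs: "set_integrable lebesgue S (\<lambda>x. \<bar>f x - k\<bar>)" for k
    by (rule set_integrable_abs[OF int])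
  have lint_const: "(LINT x:S|lebesgue. k) = measure lebesgue S * k" for k :: real
    using S by (simp add: set_lebesgue_integral_def)
  let ?J = "LINT x:S|lebesgue. \<bar>f x - c\<bar>" and ?m = "mean_value f S"
  have "measure lebesgue S * (?m - c) = (LINT x:S|lebesgue. f x - c)"
    using pos by (simp add: set_integral_diff(2)[OF f const] lint_const mean_value_def field_simps)
  then have "measure lebesgue S * \<bar>?m - c\<bar> = \<bar>LINT x:S|lebesgue. f x - c\<bar>"
    using pos by (metis abs_mult abs_of_pos)
  also have "\<dots> \<le> ?J"
    using set_integral_norm_bound[OF int] by simp
  finally have mean: "measure lebesgue S * \<bar>?m - c\<bar> \<le> ?J" .
  have "(LINT x:S|lebesgue. \<bar>f x - ?m\<bar>) \<le> (LINT x:S|lebesgue. \<bar>f x - c\<bar> + \<bar>?m - c\<bar>)"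
    by (intro set_integral_mono int_abs set_integral_add(1) const) auto
  also have "\<dots> = ?J + measure lebesgue S * \<bar>?m - c\<bar>"
    by (simp add: set_integral_add(2)[OF int_abs const] lint_const)
  also have "\<dots> \<le> 2 * ?J"
    using mean by simp
  finally show ?thesis
    using pos by (simp add: mean_osc_def divide_right_mono)
qed

lemma mean_osc_le_const:
  assumes f: "set_integrable lebesgue S f" and S: "S \<in> lmeasurable"
    and le: "\<And>x. x \<in> S \<Longrightarrow> \<bar>f x\<bar> \<le> B" and "0 \<le> B"
  shows "mean_osc f S \<le> 2 * B"
proof -
  have "(LINT x:S|lebesgue. \<bar>f x - 0\<bar>) \<le> (LINT x:S|lebesgue. B)"
    by (intro set_integral_mono set_integrable_const_lmeasurable[OF S])
      (use le set_integrable_abs[OF f] in auto)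
  also have "\<dots> = measure lebesgue S * B"
    using S by (simp add: set_lebesgue_integral_def)
  finally have "2 * (LINT x:S|lebesgue. \<bar>f x - 0\<bar>) / measure lebesgue S \<le> 2 * B"
    using \<open>0 \<le> B\<close> by (cases "measure lebesgue S = 0") (auto simp: field_simps zero_less_measure_iff)
  then show ?thesis
    using mean_osc_le[OF f S, of 0] by linarith
qed

lemma mean_osc_nonneg: "0 \<le> mean_osc f S"
  unfolding mean_osc_def set_lebesgue_integral_def
  by (intro divide_nonneg_nonneg integral_nonneg) (auto simp: indicator_def)

lemma mean_osc_uminus: "mean_osc (\<lambda>x. - f x) S = mean_osc f S"
proof -
  have "mean_value (\<lambda>x. - f x) S = - mean_value f S"
    by (simp add: mean_value_def set_lebesgue_integral_def)
  then show ?thesis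
    by (simp add: mean_osc_def abs_minus_commute)
qed

lemma mean_osc_add_le:
  assumes f: "set_integrable lebesgue S f" and g: "set_integrable lebesgue S g" and S: "S \<in> lmeasurable"
  shows "mean_osc (\<lambda>x. f x + g x) S \<le> mean_osc f S + mean_osc g S"
proof -
  have mean: "mean_value (\<lambda>x. f x + g x) S = mean_value f S + mean_value g S"
    by (simp add: mean_value_def set_integral_add(2)[OF f g] add_divide_distrib)
  have const: "set_integrable lebesgue S (\<lambda>x. k)" for k :: real
    by (rule set_integrable_const_lmeasurable[OF S])
  have int: "set_integrable lebesgue S (\<lambda>x. \<bar>h x - k\<bar>)" if "set_integrable lebesgue S h" for h :: "'a \<Rightarrow> real" and k
    by (rule set_integrable_abs[OF set_integral_diff(1)[OF that const]])
  have "(LINT x:S|lebesgue. \<bar>f x + g x - (mean_value f S + mean_value g S)\<bar>)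
      \<le> (LINT x:S|lebesgue. \<bar>f x - mean_value f S\<bar> + \<bar>g x - mean_value g S\<bar>)"
    by (intro set_integral_mono int set_integral_add(1) f g) auto
  then show ?thesis
    by (simp add: mean_osc_def mean set_integral_add(2)[OF int int, OF f g]
        divide_right_mono flip: add_divide_distrib)
qed

lemma mean_osc_diff_le:
  assumes f: "set_integrable lebesgue S f" and g: "set_integrable lebesgue S g" and S: "S \<in> lmeasurable"
  shows "mean_osc (\<lambda>x. f x - g x) S \<le> mean_osc f S + mean_osc g S"
proof -
  have "set_integrable lebesgue S (\<lambda>x. - g x)"
    using g by (simp add: set_integrable_def)
  from mean_osc_add_le[OF f this S] show ?thesis
    by (simp add: mean_osc_uminus)
qed

lemma set_integrable_lipschitz_comp:
  fixes f :: "'a::euclidean_space \<Rightarrow> real" and \<phi> :: "real \<Rightarrow> real"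
  assumes f: "set_integrable lebesgue S f" and S: "S \<in> lmeasurable"
    and \<phi>: "\<And>x y. \<bar>\<phi> x - \<phi> y\<bar> \<le> \<bar>x - y\<bar>"
  shows "set_integrable lebesgue S (\<lambda>x. \<phi> (f x))"
proof -
  have bound: "set_integrable lebesgue S (\<lambda>x. \<bar>\<phi> 0\<bar> + \<bar>f x\<bar>)"
    by (intro set_integral_add(1) set_integrable_abs f set_integrable_const_lmeasurable[OF S])
  have "continuous_on UNIV \<phi>"
    by (rule lipschitz_on_continuous_on[of 1]) (auto intro!: lipschitz_onI simp: dist_real_def \<phi>)
  then have [measurable]: "\<phi> \<in> borel_measurable borel"
    by (rule borel_measurable_continuous_onI)
  have [measurable]: "S \<in> sets lebesgue"
    using S by auto
  have [measurable]: "(\<lambda>x. indicator S x * f x) \<in> borel_measurable lebesgue"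
    using f by (auto simp: set_integrable_def)
  \<comment> \<open>Off \<open>S\<close> nothing is known about \<open>f\<close>, so
    \<open>\<phi>\<close> is applied to the cut-off function; the outer indicator is there because
    \<open>\<phi> 0\<close> need not vanish.\<close>
  have "(\<lambda>x. indicator S x * \<phi> (indicator S x * f x)) \<in> borel_measurable lebesgue"
    by measurable
  also have "(\<lambda>x. indicator S x * \<phi> (indicator S x * f x)) = (\<lambda>x. indicator S x *\<^sub>R \<phi> (f x))"
    by (auto simp: indicator_def)
  finally have meas: "set_borel_measurable lebesgue S (\<lambda>x. \<phi> (f x))"
    by (simp add: set_borel_measurable_def)
  have "norm (\<phi> (f x)) \<le> norm (\<bar>\<phi> 0\<bar> + \<bar>f x\<bar>)" for x
    using \<phi>[of "f x" 0] by simp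
  then show ?thesis
    by (intro set_integrable_bound[OF bound meas]) auto
qed

text \<open>The comparison constant is \<open>\<phi> (mean_value f S)\<close> instead of the mean of
  the composition, hence the factor 2.\<close>

lemma mean_osc_lipschitz_comp:
  fixes f :: "'a::euclidean_space \<Rightarrow> real" and \<phi> :: "real \<Rightarrow> real"
  assumes f: "set_integrable lebesgue S f" and S: "S \<in> lmeasurable"
    and \<phi>: "\<And>x y. \<bar>\<phi> x - \<phi> y\<bar> \<le> \<bar>x - y\<bar>"
  shows "mean_osc (\<lambda>x. \<phi> (f x)) S \<le> 2 * mean_osc f S"
proof -
  have const: "set_integrable lebesgue S (\<lambda>x. k)" for k :: real
    by (rule set_integrable_const_lmeasurable[OF S])
  have int: "set_integrable lebesgue S (\<lambda>x. \<bar>h x - k\<bar>)" if "set_integrable lebesgue S h" for h :: "'a \<Rightarrow> real" and k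
    by (rule set_integrable_abs[OF set_integral_diff(1)[OF that const]])
  have \<phi>f: "set_integrable lebesgue S (\<lambda>x. \<phi> (f x))"
    by (rule set_integrable_lipschitz_comp[OF f S \<phi>])
  have "mean_osc (\<lambda>x. \<phi> (f x)) S
      \<le> 2 * (LINT x:S|lebesgue. \<bar>\<phi> (f x) - \<phi> (mean_value f S)\<bar>) / measure lebesgue S"
    by (rule mean_osc_le[OF \<phi>f S])
  also have "\<dots> \<le> 2 * (LINT x:S|lebesgue. \<bar>f x - mean_value f S\<bar>) / measure lebesgue S"
    by (intro divide_right_mono mult_left_mono set_integral_mono int f \<phi>f \<phi>) auto
  finally show ?thesis
    by (simp add: mean_osc_def)
qed

lemma bmo_seminorm_le_iff:
  assumes "0 \<le> e"
  shows "bmo_seminorm \<S> f \<le> ennreal e \<longleftrightarrow> (\<forall>S\<in>\<S>. mean_osc f S \<le> e)"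
  using assms by (auto simp: bmo_seminorm_def SUP_le_iff ennreal_le_iff)

text \<open>Replaces the \<open>ennreal\<close> supremum by real bounds uniform over the family, the
  form in which convergence is used and proved below.\<close>

lemma bmo_seminorm_tendsto_0_iff:
  "(\<lambda>k. bmo_seminorm \<S> (G k)) \<longlonglongrightarrow> 0 \<longleftrightarrow>
     (\<forall>e>0. \<forall>\<^sub>F k in sequentially. \<forall>S\<in>\<S>. mean_osc (G k) S \<le> e)"
proof
  assume lim: "(\<lambda>k. bmo_seminorm \<S> (G k)) \<longlonglongrightarrow> 0"
  show "\<forall>e>0. \<forall>\<^sub>F k in sequentially. \<forall>S\<in>\<S>. mean_osc (G k) S \<le> e"
  proof (intro allI impI)
    fix e :: real
    assume "0 < e"
    then have "\<forall>\<^sub>F k in sequentially. bmo_seminorm \<S> (G k) < ennreal e"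
      using order_tendstoD(2)[OF lim, of "ennreal e"] by simp
    then show "\<forall>\<^sub>F k in sequentially. \<forall>S\<in>\<S>. mean_osc (G k) S \<le> e"
      by eventually_elim (use \<open>0 < e\<close> bmo_seminorm_le_iff[of e \<S>] less_imp_le in metis)
  qed
next
  assume *: "\<forall>e>0. \<forall>\<^sub>F k in sequentially. \<forall>S\<in>\<S>. mean_osc (G k) S \<le> e"
  show "(\<lambda>k. bmo_seminorm \<S> (G k)) \<longlonglongrightarrow> 0"
  proof (rule order_tendstoI)
    fix a :: ennreal
    assume "0 < a"
    then obtain b where b: "0 < b" "b < a"
      using dense by blast
    then obtain e where e: "b = ennreal e" "0 < e"
      by (cases b) auto
    from * e(2) have "\<forall>\<^sub>F k in sequentially. \<forall>S\<in>\<S>. mean_osc (G k) S \<le> e" by blast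
    then show "\<forall>\<^sub>F k in sequentially. bmo_seminorm \<S> (G k) < a"
      by eventually_elim
        (use b(2) e bmo_seminorm_le_iff[of e \<S>] less_imp_le le_less_trans in metis)
  qed auto
qed

lemma BMO_I:
  assumes "\<And>S. S \<in> \<S> \<Longrightarrow> set_integrable lebesgue S f" "\<And>S. S \<in> \<S> \<Longrightarrow> mean_osc f S \<le> B"
  shows "f \<in> BMO \<S>"
proof -
  have "bmo_seminorm \<S> f \<le> ennreal (max B 0)"
    using assms(2) by (subst bmo_seminorm_le_iff) (auto simp: le_max_iff_disj)
  then show ?thesis
    using assms(1) by (auto simp: BMO_def intro: le_less_trans)
qed

lemma BMO_bounded:
  assumes "f \<in> BMO \<S>"
  obtains B where "0 \<le> B" "\<And>S. S \<in> \<S> \<Longrightarrow> mean_osc f S \<le> B"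
proof -
  obtain B where "bmo_seminorm \<S> f = ennreal B" "0 \<le> B"
    using assms by (cases "bmo_seminorm \<S> f") (auto simp: BMO_def)
  then show thesis
    using that bmo_seminorm_le_iff[of B \<S> f] by auto
qed

subsection \<open>Decreasing rearrangement\<close>

lemma sets_abs_greater:
  fixes g :: "'a::euclidean_space \<Rightarrow> real"
  assumes "g \<in> borel_measurable lebesgue"
  shows "{x. \<alpha> < \<bar>g x\<bar>} \<in> sets lebesgue"
proof -
  have "{x \<in> space lebesgue. \<alpha> < \<bar>g x\<bar>} \<in> sets lebesgue"
    using assms by measurable
  then show ?thesis by simp
qed

lemma distribution_fun_antimono:
  assumes "g \<in> borel_measurable lebesgue" "\<alpha> \<le> \<beta>"
  shows "distribution_fun g \<beta> \<le> distribution_fun g \<alpha>"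
  unfolding distribution_fun_def
  by (rule emeasure_mono) (use assms sets_abs_greater in auto)

text \<open>Continuity from below along the superlevel sets at
  \<open>\<alpha> + 1 / (i + 1)\<close>, which exhaust the one at \<open>\<alpha>\<close>; infinite
  measures are covered.\<close>

lemma distribution_fun_right_continuous:
  assumes "g \<in> borel_measurable lebesgue" and s: "s < distribution_fun g \<alpha>"
  obtains \<beta> where "\<alpha> < \<beta>" "s < distribution_fun g \<beta>"
proof -
  let ?A = "\<lambda>i::nat. {x. \<alpha> + 1 / real (Suc i) < \<bar>g x\<bar>}"
  have "(SUP i. emeasure lebesgue (?A i)) = emeasure lebesgue (\<Union>i. ?A i)"
  proof (rule SUP_emeasure_incseq)
    show "incseq ?A"
    proof (rule incseq_SucI)
      fix i
      have "1 / real (Suc (Suc i)) \<le> 1 / real (Suc i)" by (intro divide_left_mono) auto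
      then show "?A i \<subseteq> ?A (Suc i)" by fastforce
    qed
  qed (use sets_abs_greater[OF assms(1)] in auto)
  also have "(\<Union>i. ?A i) = {x. \<alpha> < \<bar>g x\<bar>}"
  proof safe
    fix x assume "\<alpha> < \<bar>g x\<bar>"
    then obtain i where "inverse (real (Suc i)) < \<bar>g x\<bar> - \<alpha>"
      using reals_Archimedean[of "\<bar>g x\<bar> - \<alpha>"] by auto
    then show "x \<in> (\<Union>i. ?A i)" by (auto simp: field_simps intro!: exI[of _ i])
  next
    fix x i assume "\<alpha> + 1 / real (Suc i) < \<bar>g x\<bar>"
    moreover have "0 < 1 / real (Suc i)" by simp
    ultimately show "\<alpha> < \<bar>g x\<bar>" by linarith
  qed
  finally have "s < (SUP i. emeasure lebesgue (?A i))"
    using s by (simp add: distribution_fun_def)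
  then obtain i where "s < distribution_fun g (\<alpha> + 1 / real (Suc i))"
    by (auto simp: less_SUP_iff distribution_fun_def)
  then show thesis
    by (intro that[of "\<alpha> + 1 / real (Suc i)"]) auto
qed

text \<open>All computations with the rearrangement go through this equivalence. Rearrangeability
  bounds the set whose length defines \<open>decr_rearr g s\<close>, monotonicity makes it an
  interval starting at 0, and right continuity makes it half open, so that strict inequalities
  correspond exactly.\<close>

lemma less_decr_rearr_iff:
  assumes g: "rearrangeable g" and "0 < s" "0 \<le> \<alpha>"
  shows "\<alpha> < decr_rearr g s \<longleftrightarrow> ennreal s < distribution_fun g \<alpha>"
proof -
  have meas: "g \<in> borel_measurable lebesgue" and lim: "(distribution_fun g \<longlongrightarrow> 0) at_top"
    using g by (auto simp: rearrangeable_def)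
  let ?D = "{\<alpha>. 0 \<le> \<alpha> \<and> ennreal s < distribution_fun g \<alpha>}"
  have "\<forall>\<^sub>F \<alpha> in at_top. distribution_fun g \<alpha> < ennreal s"
    using order_tendstoD(2)[OF lim, of "ennreal s"] \<open>0 < s\<close> by simp
  then obtain N where N: "\<And>\<alpha>. N \<le> \<alpha> \<Longrightarrow> distribution_fun g \<alpha> < ennreal s"
    by (auto simp: eventually_at_top_linorder)
  \<comment> \<open>Inserting 0 keeps the supremum meaningful when no level qualifies.\<close>
  have bdd: "bdd_above (insert 0 ?D)"
  proof (rule bdd_aboveI[of _ "max 0 N"])
    fix \<alpha> assume "\<alpha> \<in> insert 0 ?D"
    then show "\<alpha> \<le> max 0 N" using N[of \<alpha>] by (cases "N \<le> \<alpha>") auto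
  qed
  define d where "d = Sup (insert 0 ?D)"
  have d0: "0 \<le> d"
    unfolding d_def by (rule cSup_upper[OF _ bdd]) simp
  have D: "?D = {0..<d}"
  proof (intro set_eqI iffI)
    fix \<alpha> assume a: "\<alpha> \<in> ?D"
    then obtain \<beta> where "\<alpha> < \<beta>" "ennreal s < distribution_fun g \<beta>"
      using distribution_fun_right_continuous[OF meas] by blast
    moreover from this a have "\<beta> \<le> d"
      unfolding d_def by (intro cSup_upper[OF _ bdd]) auto
    ultimately show "\<alpha> \<in> {0..<d}" using a by auto
  next
    fix \<alpha> assume a: "\<alpha> \<in> {0..<d}"
    then obtain y where "y \<in> insert 0 ?D" "\<alpha> < y"
      using less_cSup_iff[OF _ bdd, of \<alpha>] by (auto simp: d_def)
    then show "\<alpha> \<in> ?D"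
      using a distribution_fun_antimono[OF meas, of \<alpha> y] by (auto intro: less_le_trans)
  qed
  have "decr_rearr g s = d"
    using d0 by (simp add: decr_rearr_def D)
  then show ?thesis
    using D \<open>0 \<le> \<alpha>\<close> by (auto simp: set_eq_iff)
qed

lemma decr_rearr_nonneg: "0 \<le> decr_rearr g s"
  by (simp add: decr_rearr_def)

lemma decr_rearr_le_decr_rearr:
  assumes "rearrangeable g" "rearrangeable h" "0 < s" "0 < t"
    and "\<And>\<alpha>. 0 \<le> \<alpha> \<Longrightarrow> ennreal s < distribution_fun g \<alpha> \<Longrightarrow> ennreal t < distribution_fun h \<alpha>"
  shows "decr_rearr g s \<le> decr_rearr h t"
proof (rule ccontr)
  assume "\<not> ?thesis"
  then have "ennreal s < distribution_fun g (decr_rearr h t)"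
    using less_decr_rearr_iff[OF assms(1,3) decr_rearr_nonneg[of h t]] by auto
  then have "ennreal t < distribution_fun h (decr_rearr h t)"
    by (rule assms(5)[OF decr_rearr_nonneg])
  then show False
    using less_decr_rearr_iff[OF assms(2,4) decr_rearr_nonneg[of h t]] by auto
qed

lemma decr_rearr_antimono:
  assumes "rearrangeable g" "0 < s" "s \<le> t"
  shows "decr_rearr g t \<le> decr_rearr g s"
  using assms by (intro decr_rearr_le_decr_rearr) (auto intro: le_less_trans[OF ennreal_leI])

lemma decr_rearr_mono_fun:
  assumes "rearrangeable g" "rearrangeable h" "0 < s" "\<And>x. \<bar>g x\<bar> \<le> \<bar>h x\<bar>"
  shows "decr_rearr g s \<le> decr_rearr h s"
proof (rule decr_rearr_le_decr_rearr)
  fix \<alpha> :: real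
  have "distribution_fun g \<alpha> \<le> distribution_fun h \<alpha>"
    unfolding distribution_fun_def using assms(2,4)
    by (intro emeasure_mono sets_abs_greater) (auto simp: rearrangeable_def intro: less_le_trans)
  then show "ennreal s < distribution_fun h \<alpha>" if "ennreal s < distribution_fun g \<alpha>"
    using that by (rule less_le_trans[rotated])
qed (use assms in auto)

text \<open>The superlevel sets of increasing nonnegative functions grow to that of the limit, so
  their measures converge from below. A strict lower bound is thus reached at one index and then
  persists.\<close>

lemma decr_rearr_eventually_gt:
  assumes F: "\<And>k. rearrangeable (F k)" and f: "rearrangeable f"
    and inc: "\<And>x. incseq (\<lambda>k. F k x)" and lim: "\<And>x. (\<lambda>k. F k x) \<longlonglongrightarrow> f x"
    and nonneg: "\<And>k x. 0 \<le> F k x"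
    and "0 < s" "0 \<le> v" "v < decr_rearr f s"
  shows "\<forall>\<^sub>F k in sequentially. v < decr_rearr (F k) s"
proof -
  have meas: "{x. v < \<bar>F k x\<bar>} \<in> sets lebesgue" for k
    using F by (intro sets_abs_greater) (auto simp: rearrangeable_def)
  let ?A = "\<lambda>k. {x. v < \<bar>F k x\<bar>}"
  have f_nonneg: "0 \<le> f x" for x
    by (rule LIMSEQ_le_const[OF lim]) (use nonneg in auto)
  have mono: "?A k \<subseteq> ?A l" if "k \<le> l" for k l
    using incseqD[OF inc that] nonneg by (auto intro: less_le_trans)
  have "(SUP k. emeasure lebesgue (?A k)) = emeasure lebesgue (\<Union>k. ?A k)"
    using mono meas by (intro SUP_emeasure_incseq) (auto simp: incseq_def)
  also have "(\<Union>k. ?A k) = {x. v < \<bar>f x\<bar>}"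
  proof safe
    fix x assume "v < \<bar>f x\<bar>"
    then have "\<forall>\<^sub>F k in sequentially. v < F k x"
      using order_tendstoD(1)[OF lim] f_nonneg by simp
    then show "x \<in> (\<Union>k. ?A k)"
      using eventually_happens nonneg by fastforce
  next
    fix x k assume "v < \<bar>F k x\<bar>"
    then show "v < \<bar>f x\<bar>"
      using incseq_le[OF inc lim, of k x] nonneg[of k x] by simp
  qed
  finally have "ennreal s < (SUP k. distribution_fun (F k) v)"
    using less_decr_rearr_iff[OF f \<open>0 < s\<close> \<open>0 \<le> v\<close>] \<open>v < decr_rearr f s\<close>
    by (simp add: distribution_fun_def)
  then obtain k where "ennreal s < distribution_fun (F k) v"
    by (auto simp: less_SUP_iff)
  moreover have "distribution_fun (F k) v \<le> distribution_fun (F l) v" if "k \<le> l" for l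
    unfolding distribution_fun_def by (intro emeasure_mono mono meas that)
  ultimately have "\<forall>l\<ge>k. v < decr_rearr (F l) s"
    using less_decr_rearr_iff[OF F \<open>0 < s\<close> \<open>0 \<le> v\<close>] by (meson less_le_trans)
  then show ?thesis
    by (auto simp: eventually_sequentially)
qed

lemma rearrangeable_truncate:
  assumes g: "rearrangeable g" and nonneg: "\<And>x. 0 \<le> g x" and "0 \<le> t"
  shows "rearrangeable (\<lambda>x. max (g x - t) 0)"
proof -
  have [measurable]: "g \<in> borel_measurable lebesgue" and lim: "(distribution_fun g \<longlongrightarrow> 0) at_top"
    using g by (auto simp: rearrangeable_def)
  have "distribution_fun (\<lambda>x. max (g x - t) 0) \<alpha> \<le> distribution_fun g \<alpha>" for \<alpha>
    unfolding distribution_fun_def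
    by (rule emeasure_mono, clarsimp) (use nonneg \<open>0 \<le> t\<close> in \<open>smt (verit)\<close>, rule sets_abs_greater, measurable)
  then have "(distribution_fun (\<lambda>x. max (g x - t) 0) \<longlongrightarrow> 0) at_top"
    by (intro tendsto_sandwich[OF _ _ tendsto_const lim]) auto
  then show ?thesis
    by (simp add: rearrangeable_def)
qed

text \<open>Truncation shifts the distribution function by \<open>t\<close>. This lets the bound
  assumed for rearrangements act on the part of \<open>g\<^sup>*\<close> above \<open>t\<close>
  alone.\<close>

lemma decr_rearr_truncate:
  assumes g: "rearrangeable g" and nonneg: "\<And>x. 0 \<le> g x" and "0 \<le> t" "0 < s"
  shows "decr_rearr (\<lambda>x. max (g x - t) 0) s = max (decr_rearr g s - t) 0"
proof -
  have "distribution_fun (\<lambda>x. max (g x - t) 0) \<alpha> = distribution_fun g (\<alpha> + t)" if "0 \<le> \<alpha>" for \<alpha>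
    unfolding distribution_fun_def
    by (rule arg_cong[where f = "emeasure lebesgue"]) (use that nonneg \<open>0 \<le> t\<close> in \<open>force simp: max_def\<close>)
  then have "{\<alpha>. 0 \<le> \<alpha> \<and> ennreal s < distribution_fun (\<lambda>x. max (g x - t) 0) \<alpha>} = {0..<decr_rearr g s - t}"
    using less_decr_rearr_iff[OF g \<open>0 < s\<close>] \<open>0 \<le> t\<close> by (auto simp: less_diff_eq)
  then have "decr_rearr (\<lambda>x. max (g x - t) 0) s = measure lebesgue {0..<decr_rearr g s - t}"
    unfolding decr_rearr_def[of "\<lambda>x. max (g x - t) 0"] by simp
  then show ?thesis
    by (simp add: max_def)
qed

lemma decr_rearr_borel_measurable:
  assumes "rearrangeable g"
  shows "decr_rearr g \<in> borel_measurable borel"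
proof -
  have "mono_on {0<..} (\<lambda>s. - decr_rearr g s)"
    using decr_rearr_antimono[OF assms] by (auto simp: mono_on_def)
  then have "(\<lambda>s. - decr_rearr g s) \<in> borel_measurable (restrict_space borel {0<..})"
    by (rule borel_measurable_mono_on_fnc)
  then have pos: "decr_rearr g \<in> borel_measurable (restrict_space borel {0<..})"
    by simp
  \<comment> \<open>\<open>ennreal\<close> sends every \<open>s \<le> 0\<close> to 0, so the values
    without meaning are all equal.\<close>
  have "decr_rearr g \<in> borel_measurable (restrict_space borel (- {0<..})) \<longleftrightarrow>
      (\<lambda>s::real. decr_rearr g 0) \<in> borel_measurable (restrict_space borel (- {0<..}))"
    by (intro measurable_cong) (auto simp: space_restrict_space decr_rearr_def ennreal_neg)
  then have neg: "decr_rearr g \<in> borel_measurable (restrict_space borel (- {0<..}))"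
    by simp
  show ?thesis
    by (rule measurable_piecewise_restrict[of "{{0<..}, - {0<..}}"]) (use pos neg in auto)
qed

subsection \<open>Layer cake\<close>

lemma sigma_finite_lebesgue: "sigma_finite_measure (lebesgue :: 'a::euclidean_space measure)"
proof
  obtain A :: "nat \<Rightarrow> 'a set" where "range A \<subseteq> sets lborel" "(\<Union>i. A i) = space lborel"
    "\<And>i. emeasure lborel (A i) \<noteq> \<infinity>"
    using lborel.sigma_finite by blast
  then show "\<exists>A::'a set set. countable A \<and> A \<subseteq> sets lebesgue \<and> \<Union> A = space lebesgue \<and>
      (\<forall>a\<in>A. emeasure lebesgue a \<noteq> \<infinity>)"
    by (intro exI[of _ "range A"]) auto
qed

text \<open>Fubini for the region under the graph. Negative values of \<open>u\<close> count on
  neither side: \<open>ennreal\<close> sends them to 0, and the levels are nonnegative.\<close>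

lemma (in sigma_finite_measure) layer_cake:
  assumes [measurable]: "u \<in> borel_measurable M"
  shows "(\<integral>\<^sup>+ x. ennreal (u x) \<partial>M) =
    (\<integral>\<^sup>+ \<alpha>. indicator {0..} \<alpha> * emeasure M {x\<in>space M. \<alpha> < u x} \<partial>lborel)"
proof -
  interpret P: pair_sigma_finite M "lborel :: real measure" ..
  define H :: "'a \<Rightarrow> real \<Rightarrow> ennreal" where "H x \<alpha> = (if 0 \<le> \<alpha> \<and> \<alpha> < u x then 1 else 0)" for x \<alpha>
  have "(\<integral>\<^sup>+ x. ennreal (u x) \<partial>M) = (\<integral>\<^sup>+ x. (\<integral>\<^sup>+ \<alpha>. H x \<alpha> \<partial>lborel) \<partial>M)"
  proof (rule nn_integral_cong)
    fix x
    have "(\<integral>\<^sup>+ \<alpha>. H x \<alpha> \<partial>lborel) = (\<integral>\<^sup>+ \<alpha>. indicator {0..<u x} \<alpha> \<partial>lborel)"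
      by (intro nn_integral_cong) (auto simp: H_def)
    also have "\<dots> = ennreal (u x)"
      by (cases "0 \<le> u x") (auto simp: ennreal_neg)
    finally show "ennreal (u x) = (\<integral>\<^sup>+ \<alpha>. H x \<alpha> \<partial>lborel)" ..
  qed
  also have "\<dots> = (\<integral>\<^sup>+ \<alpha>. (\<integral>\<^sup>+ x. H x \<alpha> \<partial>M) \<partial>lborel)"
    unfolding H_def by (rule P.Fubini'[symmetric]) measurable
  also have "\<dots> = (\<integral>\<^sup>+ \<alpha>. indicator {0..} \<alpha> * emeasure M {x\<in>space M. \<alpha> < u x} \<partial>lborel)"
  proof (rule nn_integral_cong)
    fix \<alpha> :: real
    have "(\<integral>\<^sup>+ x. H x \<alpha> \<partial>M) = (\<integral>\<^sup>+ x. indicator {0..} \<alpha> * indicator {x\<in>space M. \<alpha> < u x} x \<partial>M)"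
      by (intro nn_integral_cong) (auto simp: H_def indicator_def)
    also have "\<dots> = indicator {0..} \<alpha> * emeasure M {x\<in>space M. \<alpha> < u x}"
      by (simp add: nn_integral_cmult)
    finally show "(\<integral>\<^sup>+ x. H x \<alpha> \<partial>M) = indicator {0..} \<alpha> * emeasure M {x\<in>space M. \<alpha> < u x}" .
  qed
  finally show ?thesis .
qed

text \<open>Superlevel sets of \<open>g\<close> and of \<open>g\<^sup>*\<close> on the positive half
  line have equal measure, so the layer cakes above \<open>t\<close> agree. The test
  \<open>0 < s\<close> discards the meaningless values of \<open>decr_rearr\<close>, and
  \<open>ennreal\<close> takes the positive part.\<close>

lemma nn_integral_truncate_eq_decr_rearr:
  assumes g: "rearrangeable g" and nonneg: "\<And>x. 0 \<le> g x" and "0 \<le> t"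
  shows "(\<integral>\<^sup>+ x. ennreal (g x - t) \<partial>lebesgue) =
    (\<integral>\<^sup>+ s. ennreal (if 0 < s then decr_rearr g s - t else 0) \<partial>lborel)"
proof -
  interpret leb: sigma_finite_measure "lebesgue :: 'a measure"
    by (rule sigma_finite_lebesgue)
  have [measurable]: "g \<in> borel_measurable lebesgue"
    using g by (simp add: rearrangeable_def)
  have [measurable]: "decr_rearr g \<in> borel_measurable borel"
    by (rule decr_rearr_borel_measurable[OF g])
  have level: "emeasure lebesgue {x \<in> space lebesgue. \<alpha> < g x - t} =
      emeasure lborel {s \<in> space lborel. \<alpha> < (if 0 < s then decr_rearr g s - t else 0)}"
    if "0 \<le> \<alpha>" for \<alpha>
  proof -
    have "emeasure lebesgue {x \<in> space lebesgue. \<alpha> < g x - t} = distribution_fun g (\<alpha> + t)"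
      unfolding distribution_fun_def
      by (rule arg_cong[where f = "emeasure lebesgue"]) (use nonneg in \<open>auto simp: less_diff_eq\<close>)
    moreover have "{s \<in> space lborel. \<alpha> < (if 0 < s then decr_rearr g s - t else 0)} =
        {s. 0 < s \<and> ennreal s < distribution_fun g (\<alpha> + t)}"
      using less_decr_rearr_iff[OF g, of _ "\<alpha> + t"] that \<open>0 \<le> t\<close> by (auto simp: less_diff_eq)
    moreover have "emeasure lborel {s. 0 < s \<and> ennreal s < distribution_fun g (\<alpha> + t)} =
        distribution_fun g (\<alpha> + t)"
    proof (cases "distribution_fun g (\<alpha> + t)")
      case (real r)
      then have "{s. 0 < s \<and> ennreal s < distribution_fun g (\<alpha> + t)} = {0<..<r}"
        by (auto simp: ennreal_less_iff)
      then show ?thesis using real by simp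
    next
      case top
      then have eq: "{s. 0 < s \<and> ennreal s < distribution_fun g (\<alpha> + t)} = {0<..}"
        by auto
      have "of_nat n \<le> emeasure lborel {0::real<..}" for n
        using emeasure_mono[of "{0<..<real n}" "{0<..}" lborel]
        by (force simp: ennreal_of_nat_eq_real_of_nat)
      then have "emeasure lborel {0::real<..} = top"
        by (metis ennreal_Ex_less_of_nat leD less_top)
      then show ?thesis using eq top by simp
    qed
    ultimately show ?thesis by simp
  qed
  have "(\<integral>\<^sup>+ x. ennreal (g x - t) \<partial>lebesgue) = (\<integral>\<^sup>+ \<alpha>. indicator {0..} \<alpha> *
      emeasure lebesgue {x \<in> space lebesgue. \<alpha> < g x - t} \<partial>lborel)"
    by (rule leb.layer_cake) measurable
  also have "\<dots> = (\<integral>\<^sup>+ \<alpha>. indicator {0..} \<alpha> *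
      emeasure lborel {s \<in> space lborel. \<alpha> < (if 0 < s then decr_rearr g s - t else 0)} \<partial>lborel)"
  proof (rule nn_integral_cong)
    fix \<alpha> :: real
    show "indicator {0..} \<alpha> * emeasure lebesgue {x \<in> space lebesgue. \<alpha> < g x - t} = indicator {0..} \<alpha> *
        emeasure lborel {s \<in> space lborel. \<alpha> < (if 0 < s then decr_rearr g s - t else 0)}"
    proof (cases "0 \<le> \<alpha>")
      case True
      then show ?thesis by (simp only: level[OF True])
    qed simp
  qed
  also have "\<dots> = (\<integral>\<^sup>+ s. ennreal (if 0 < s then decr_rearr g s - t else 0) \<partial>lborel)"
    by (rule lborel.layer_cake[symmetric]) measurable
  finally show ?thesis .
qed

text \<open>Above a level that \<open>g\<close> exceeds only on a set of measure less than 1, the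
  excess of \<open>g\<^sup>*\<close> lives on the interval from 0 to 1, where
  \<open>g\<^sup>*\<close> is integrable. So the mass of \<open>g\<close> above that level is
  finite, and raising the level sends it to 0 by dominated convergence.\<close>

lemma nn_integral_truncate_small:
  assumes g: "rearrangeable g" and nonneg: "\<And>x. 0 \<le> g x"
    and int: "set_integrable lebesgue {0<..<1} (decr_rearr g)" and "0 < e"
  obtains t where "t0 \<le> t" "0 \<le> t" "(\<integral>\<^sup>+ x. ennreal (g x - t) \<partial>lebesgue) < e"
proof -
  have [measurable]: "g \<in> borel_measurable lebesgue" and lim: "(distribution_fun g \<longlongrightarrow> 0) at_top"
    using g by (auto simp: rearrangeable_def)
  have "\<forall>\<^sub>F \<alpha> in at_top. distribution_fun g \<alpha> < 1 \<and> max t0 0 \<le> \<alpha>"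
    by (intro eventually_conj order_tendstoD(2)[OF lim] eventually_ge_at_top) simp
  then obtain T where T: "distribution_fun g T < 1" "t0 \<le> T" "0 \<le> T"
    using eventually_happens'[OF trivial_limit_at_top_linorder] by fastforce
  have le: "decr_rearr g s \<le> T" if "1 \<le> s" for s
  proof (rule ccontr)
    assume "\<not> ?thesis"
    then have "ennreal s < distribution_fun g T"
      using less_decr_rearr_iff[OF g, of s T] T that by simp
    moreover have "1 \<le> ennreal s" using that by simp
    ultimately show False using T(1) by (meson leD le_less_trans less_imp_le)
  qed
  have "(\<integral>\<^sup>+ x. ennreal (g x - T) \<partial>lebesgue) =
      (\<integral>\<^sup>+ s. ennreal (if 0 < s then decr_rearr g s - T else 0) \<partial>lborel)"
    by (rule nn_integral_truncate_eq_decr_rearr[OF g nonneg T(3)])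
  also have "\<dots> \<le> (\<integral>\<^sup>+ s. ennreal (indicator {0<..<1} s *\<^sub>R decr_rearr g s) \<partial>lborel)"
    using T(3) le decr_rearr_nonneg[of g] by (intro nn_integral_mono ennreal_leI) (auto simp: indicator_def)
  also have "\<dots> = (\<integral>\<^sup>+ s. ennreal (norm (indicator {0<..<1} s *\<^sub>R decr_rearr g s)) \<partial>lebesgue)"
    using decr_rearr_nonneg[of g] by (simp add: nn_integral_completion)
  also have "\<dots> < \<infinity>"
    using int unfolding set_integrable_def integrable_iff_bounded by blast
  finally have fin: "(\<integral>\<^sup>+ x. ennreal (g x - T) \<partial>lebesgue) < \<infinity>" .
  have "(\<lambda>n. \<integral>\<^sup>+ x. ennreal (g x - (T + real n)) \<partial>lebesgue) \<longlonglongrightarrow> (\<integral>\<^sup>+ (x::'a). 0 \<partial>lebesgue)"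
  proof (rule nn_integral_dominated_convergence[OF _ _ _ _ fin])
    show "AE x in lebesgue. (\<lambda>n. ennreal (g x - (T + real n))) \<longlonglongrightarrow> 0"
    proof (intro AE_I2 tendsto_eventually)
      fix x
      obtain m :: nat where "g x - T \<le> real m" using real_arch_simple by blast
      then show "\<forall>\<^sub>F n in sequentially. ennreal (g x - (T + real n)) = 0"
        by (intro eventually_sequentiallyI[of m]) (auto intro!: ennreal_neg)
    qed
  qed (auto intro!: AE_I2 ennreal_leI)
  then have "\<forall>\<^sub>F n in sequentially. (\<integral>\<^sup>+ x. ennreal (g x - (T + real n)) \<partial>lebesgue) < e"
    using order_tendstoD(2) \<open>0 < e\<close> by fastforce
  then obtain n where "(\<integral>\<^sup>+ x. ennreal (g x - (T + real n)) \<partial>lebesgue) < e"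
    using eventually_happens by fastforce
  then show thesis
    using T by (intro that[of "T + real n"]) auto
qed

text \<open>Over a shape of measure at least \<open>\<delta>\<close>, a mean is at most the total
  mass divided by \<open>\<delta>\<close>. The 2 in the bound on the mass pays for comparing with
  the constant 0 instead of the mean.\<close>

lemma mean_osc_truncate_le:
  assumes int: "set_integrable lebesgue S (\<lambda>x. max (g x - t) 0)"
    and S: "S \<in> lmeasurable" and le: "\<And>x. g x \<le> f x" and "0 < \<delta>" "\<delta> \<le> measure lebesgue S" "0 \<le> e"
    and small: "(\<integral>\<^sup>+ x. ennreal (f x - t) \<partial>lebesgue) \<le> ennreal (e * \<delta> / 2)"
  shows "mean_osc (\<lambda>x. max (g x - t) 0) S \<le> e"
proof -
  have "ennreal (LINT x:S|lebesgue. max (g x - t) 0) =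
      (\<integral>\<^sup>+ x. ennreal (indicator S x *\<^sub>R max (g x - t) 0) \<partial>lebesgue)"
    using int unfolding set_lebesgue_integral_def set_integrable_def
    by (intro nn_integral_eq_integral[symmetric]) auto
  also have "\<dots> \<le> (\<integral>\<^sup>+ x. ennreal (f x - t) \<partial>lebesgue)"
  proof (rule nn_integral_mono)
    fix x
    have "ennreal (indicator S x *\<^sub>R max (g x - t) 0) \<le> ennreal (max (f x - t) 0)"
      using le[of x] by (intro ennreal_leI) (auto simp: indicator_def)
    then show "ennreal (indicator S x *\<^sub>R max (g x - t) 0) \<le> ennreal (f x - t)"
      by (cases "f x \<le> t") (auto simp: ennreal_neg)
  qed
  also note small
  finally have "(LINT x:S|lebesgue. max (g x - t) 0) \<le> e * \<delta> / 2"
    using \<open>0 \<le> e\<close> \<open>0 < \<delta>\<close> by (subst (asm) ennreal_le_iff) auto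
  then have "2 * (LINT x:S|lebesgue. max (g x - t) 0) / measure lebesgue S \<le> e * \<delta> / measure lebesgue S"
    by (intro divide_right_mono) auto
  also have "\<dots> \<le> e * measure lebesgue S / measure lebesgue S"
    using assms by (intro divide_right_mono mult_left_mono) auto
  finally show ?thesis
    using mean_osc_le[OF int S, of 0] \<open>0 < \<delta>\<close> \<open>\<delta> \<le> measure lebesgue S\<close> by simp
qed

subsection \<open>Level gaps\<close>

text \<open>With \<open>c\<close> the mean, \<open>f\<close> deviates from it by at least
  \<open>b - c\<close> on \<open>E\<close> and \<open>c - a\<close> off \<open>E\<close>; the
  positive parts \<open>p\<close> and \<open>r\<close> sum to at least \<open>b - a\<close>. The
  density and its complement are each at least their product, which gives a lower bound symmetric in
  both.\<close>

lemma mean_osc_ge_gap: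
  assumes int: "set_integrable lebesgue S f" and S: "S \<in> lmeasurable" "0 < measure lebesgue S"
    and E: "E \<in> sets lebesgue" and "a \<le> b"
    and up: "AE x in lebesgue. x \<in> E \<longrightarrow> b \<le> f x" and low: "AE x in lebesgue. x \<notin> E \<longrightarrow> f x \<le> a"
  shows "(b - a) * (shape_density E S * (1 - shape_density E S)) \<le> mean_osc f S"
proof -
  let ?m = "measure lebesgue S" and ?e = "measure lebesgue (E \<inter> S)"
  define c where "c = mean_value f S"
  define p where "p = max (b - c) 0"
  define r where "r = max (c - a) 0"
  have ES: "E \<inter> S \<in> lmeasurable" "S - E \<in> lmeasurable"
    using fmeasurable_Int_fmeasurable[OF S(1) E] fmeasurable_Diff[OF S(1) E] by (auto simp: Int_commute)
  have "S - E = S - E \<inter> S" by blast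
  then have e: "?e \<le> ?m" "measure lebesgue (S - E) = ?m - ?e"
    using measure_mono_fmeasurable[of "E \<inter> S" S lebesgue] ES(1) S(1)
      measurable_measure_Diff[OF S(1), of "E \<inter> S"] by auto
  have "p * ?e + r * (?m - ?e)
      = (\<integral>x. p * indicator (E \<inter> S) x + r * indicator (S - E) x \<partial>lebesgue)"
    using ES e by (simp add: lmeasurable_iff_integrable)
  also have "\<dots> \<le> (\<integral>x. indicator S x *\<^sub>R \<bar>f x - c\<bar> \<partial>lebesgue)"
  proof (rule integral_mono_AE)
    show "integrable lebesgue (\<lambda>x. indicator S x *\<^sub>R \<bar>f x - c\<bar>)"
      using set_integrable_abs[OF set_integral_diff(1)[OF int set_integrable_const_lmeasurable[OF S(1)]]]
      unfolding set_integrable_def .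
    show "AE x in lebesgue. p * indicator (E \<inter> S) x + r * indicator (S - E) x
        \<le> indicator S x *\<^sub>R \<bar>f x - c\<bar>"
      using up low by eventually_elim (auto simp: indicator_def p_def r_def)
  qed (use ES in \<open>simp add: lmeasurable_iff_integrable\<close>)
  finally have osc: "p * ?e + r * (?m - ?e) \<le> ?m * mean_osc f S"
    using S(2) by (simp add: mean_osc_def set_lebesgue_integral_def c_def)
  define \<rho> where "\<rho> = shape_density E S"
  have \<rho>: "0 \<le> \<rho>" "\<rho> \<le> 1" "?e = \<rho> * ?m"
    using e(1) S(2) by (auto simp: \<rho>_def shape_density_def)
  have "?m * (p * \<rho> + r * (1 - \<rho>)) \<le> ?m * mean_osc f S"
    using osc by (simp add: \<rho>(3) algebra_simps)
  then have "p * \<rho> + r * (1 - \<rho>) \<le> mean_osc f S"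
    using S(2) by simp
  moreover have "p * (\<rho> * (1 - \<rho>)) \<le> p * \<rho>" "r * (\<rho> * (1 - \<rho>)) \<le> r * (1 - \<rho>)"
    using \<rho> by (auto intro!: mult_left_mono mult_left_le mult_left_le_one_le simp: p_def r_def)
  moreover have "(b - a) * (\<rho> * (1 - \<rho>)) \<le> (p + r) * (\<rho> * (1 - \<rho>))"
    using \<rho> by (intro mult_right_mono) (auto simp: p_def r_def)
  ultimately show ?thesis
    by (simp add: \<rho>_def algebra_simps)
qed

text \<open>An upper limit of at least a given positive number guarantees, along small shapes, only
  values above smaller constants; hence the witness is half the original \<open>q\<close>.\<close>

lemma density_condition_small_shape:
  assumes "density_condition \<S>"
  obtains q where "0 < q"
    "\<And>E \<delta>. E \<in> sets lebesgue \<Longrightarrow> 0 < emeasure lebesgue E \<Longrightarrow> 0 < emeasure lebesgue (- E) \<Longrightarrow> 0 < \<delta> \<Longrightarrow>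
      \<exists>S\<in>\<S>. measure lebesgue S \<le> \<delta> \<and> q \<le> shape_density E S * (1 - shape_density E S)"
proof -
  let ?d = "\<lambda>E S. shape_density E S * (1 - shape_density E S)"
  obtain q :: real where q: "0 < q" and lim: "\<And>E. E \<in> sets lebesgue \<Longrightarrow> 0 < emeasure lebesgue E \<Longrightarrow>
      0 < emeasure lebesgue (- E) \<Longrightarrow> ereal q \<le> Limsup (shrinking \<S>) (\<lambda>S. ereal (?d E S))"
    using assms by (auto simp: density_condition_def)
  have "\<exists>S\<in>\<S>. measure lebesgue S \<le> \<delta> \<and> q / 2 \<le> ?d E S"
    if E: "E \<in> sets lebesgue" "0 < emeasure lebesgue E" "0 < emeasure lebesgue (- E)" "0 < \<delta>" for E and \<delta> :: real
  proof (rule ccontr)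
    assume no: "\<not> ?thesis"
    have "\<forall>\<^sub>F m in at_right 0. m \<le> \<delta>"
      using \<open>0 < \<delta>\<close> by (auto simp: eventually_at_right_field intro!: exI[of _ \<delta>])
    then have "\<forall>\<^sub>F S in shrinking \<S>. ?d E S \<le> q / 2"
      using no unfolding shrinking_def eventually_inf_principal eventually_filtercomap
      by (intro exI[of _ "\<lambda>m. m \<le> \<delta>"]) (auto simp: not_le intro: less_imp_le)
    then have "Limsup (shrinking \<S>) (\<lambda>S. ereal (?d E S)) \<le> ereal (q / 2)"
      by (intro Limsup_bounded) auto
    then have "ereal q \<le> ereal (q / 2)"
      using lim[OF E(1-3)] by (rule order_trans[rotated])
    then show False using q by simp
  qed
  then show thesis
    using q by (intro that[of "q / 2"]) auto
qed

lemma VMO_small: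
  assumes "f \<in> VMO \<S>" "0 < e"
  obtains \<delta> where "0 < \<delta>" "\<And>S. S \<in> \<S> \<Longrightarrow> measure lebesgue S \<le> \<delta> \<Longrightarrow> mean_osc f S \<le> e"
proof -
  have "((\<lambda>\<delta>. SUP S\<in>{S\<in>\<S>. measure lebesgue S \<le> \<delta>}. ennreal (mean_osc f S)) \<longlongrightarrow> 0) (at_right 0)"
    using assms by (simp add: VMO_def)
  from order_tendstoD(2)[OF this, of "ennreal e"]
  have "\<forall>\<^sub>F \<delta> in at_right 0. (SUP S\<in>{S\<in>\<S>. measure lebesgue S \<le> \<delta>}. ennreal (mean_osc f S)) < ennreal e"
    using \<open>0 < e\<close> by simp
  then obtain d where d: "0 < d" "\<And>\<delta>. 0 < \<delta> \<Longrightarrow> \<delta> < d \<Longrightarrow>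
      (SUP S\<in>{S\<in>\<S>. measure lebesgue S \<le> \<delta>}. ennreal (mean_osc f S)) < ennreal e"
    by (auto simp: eventually_at_right_field)
  show thesis
  proof (rule that[of "d / 2"])
    fix S assume "S \<in> \<S>" "measure lebesgue S \<le> d / 2"
    then have "ennreal (mean_osc f S) \<le> (SUP S\<in>{S\<in>\<S>. measure lebesgue S \<le> d / 2}. ennreal (mean_osc f S))"
      by (intro SUP_upper) simp
    also have "\<dots> < ennreal e"
      using d(1) by (intro d(2)) auto
    finally show "mean_osc f S \<le> e"
      using \<open>0 < e\<close> by (simp add: ennreal_less_iff mean_osc_nonneg less_imp_le)
  qed (use d in simp)
qed

lemma basis_of_shapes_lmeasurable:
  assumes "basis_of_shapes \<S>" "S \<in> \<S>"
  shows "S \<in> lmeasurable" "0 < measure lebesgue S"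
proof -
  have S: "open S" "0 < emeasure lebesgue S" "emeasure lebesgue S < \<infinity>"
    using assms unfolding basis_of_shapes_def by blast+
  show "S \<in> lmeasurable"
    by (rule fmeasurableI[OF _ S(3)]) (use S(1) in auto)
  show "0 < measure lebesgue S"
    unfolding measure_def enn2real_positive_iff using S by simp
qed

text \<open>If the measure did not drop, \<open>f\<close> would be at least \<open>b\<close> almost
  everywhere on the set where it exceeds \<open>a\<close>. The density condition then yields
  arbitrarily small shapes with oscillation at least \<open>(b - a) * q\<close>, against vanishing
  mean oscillation.\<close>

lemma VMO_no_level_gap:
  assumes \<S>: "basis_of_shapes \<S>" and dens: "density_condition \<S>" and f: "f \<in> VMO \<S>"
    and meas: "f \<in> borel_measurable lebesgue" and nonneg: "\<And>x. 0 \<le> f x"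
    and "a < b" "distribution_fun f a \<noteq> 0" "distribution_fun f a < \<infinity>"
  shows "distribution_fun f b < distribution_fun f a"
proof (rule ccontr)
  assume no: "\<not> ?thesis"
  have meas': "{x. \<alpha> < \<bar>f x\<bar>} \<in> sets lebesgue" for \<alpha>
    by (rule sets_abs_greater[OF meas])
  let ?E = "{x. a < \<bar>f x\<bar>}" and ?E' = "{x. b < \<bar>f x\<bar>}"
  have sub: "?E' \<subseteq> ?E" using \<open>a < b\<close> by auto
  have eq: "emeasure lebesgue ?E' = emeasure lebesgue ?E"
    using no distribution_fun_antimono[OF meas less_imp_le[OF \<open>a < b\<close>]]
    by (auto simp: distribution_fun_def)
  have fin: "emeasure lebesgue ?E < \<infinity>"
    using assms by (simp add: distribution_fun_def)
  have "emeasure lebesgue (?E - ?E') = 0"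
    using eq fin sub meas' by (subst emeasure_Diff) auto
  then have null: "?E - ?E' \<in> null_sets lebesgue"
    using meas' by auto
  \<comment> \<open>The density condition needs positive measure on both sides; here it follows from
    finiteness of the measure of \<open>?E\<close>.\<close>
  have "emeasure lebesgue (- ?E) \<noteq> 0"
  proof
    assume "emeasure lebesgue (- ?E) = 0"
    then have "emeasure lebesgue (UNIV :: 'a set) \<le> emeasure lebesgue ?E"
      using emeasure_subadditive[of ?E lebesgue "- ?E"] meas' sets.compl_sets[OF meas'[of a]]
      by (simp add: Compl_partition Compl_eq_Diff_UNIV)
    then show False using fin by simp
  qed
  then have pos: "0 < emeasure lebesgue (- ?E)" "0 < emeasure lebesgue ?E"
    using assms by (auto simp: distribution_fun_def zero_less_iff_neq_zero)
  obtain q where q: "0 < q" "\<And>\<delta>. 0 < \<delta> \<Longrightarrow>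
      \<exists>S\<in>\<S>. measure lebesgue S \<le> \<delta> \<and> q \<le> shape_density ?E S * (1 - shape_density ?E S)"
    using density_condition_small_shape[OF dens] meas' pos by metis
  obtain \<delta> where \<delta>: "0 < \<delta>" "\<And>S. S \<in> \<S> \<Longrightarrow> measure lebesgue S \<le> \<delta> \<Longrightarrow> mean_osc f S \<le> (b - a) * q / 2"
    using VMO_small[OF f, of "(b - a) * q / 2"] q \<open>a < b\<close> by auto
  obtain S where S: "S \<in> \<S>" "measure lebesgue S \<le> \<delta>"
      "q \<le> shape_density ?E S * (1 - shape_density ?E S)"
    using q(2)[OF \<delta>(1)] by blast
  have "(b - a) * q \<le> (b - a) * (shape_density ?E S * (1 - shape_density ?E S))"
    using S(3) \<open>a < b\<close> by (intro mult_left_mono) auto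
  also have "\<dots> \<le> mean_osc f S"
  proof (rule mean_osc_ge_gap)
    show "set_integrable lebesgue S f"
      using f S(1) by (auto simp: VMO_def BMO_def)
    show "AE x in lebesgue. x \<in> ?E \<longrightarrow> b \<le> f x"
      by (rule AE_I'[OF null]) (use nonneg in auto)
    show "AE x in lebesgue. x \<notin> ?E \<longrightarrow> f x \<le> a"
      using nonneg by auto
  qed (use basis_of_shapes_lmeasurable[OF \<S> S(1)] meas' \<open>a < b\<close> in auto)
  also have "\<dots> \<le> (b - a) * q / 2"
    by (rule \<delta>(2)[OF S(1,2)])
  finally show False
    using q(1) \<open>a < b\<close> by (simp add: mult_le_0_iff)
qed

text \<open>The witness \<open>r\<close> is the measure of the superlevel set at the midpoint
  \<open>m\<close>: there \<open>f\<^sup>*\<close> is at most \<open>m\<close>, and it exceeds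
  \<open>a\<close> because the distribution function drops strictly from \<open>a\<close> to
  \<open>m\<close>. The argument \<open>s\<close> makes that function finite at \<open>a\<close>,
  and \<open>s'\<close> makes it positive at \<open>m\<close>.\<close>

lemma decr_rearr_no_gap:
  assumes \<S>: "basis_of_shapes \<S>" and dens: "density_condition \<S>" and f: "f \<in> VMO \<S>"
    and rearr: "rearrangeable f" and nonneg: "\<And>x. 0 \<le> f x"
    and "0 \<le> a" "a < b" "0 < s" "decr_rearr f s \<le> a" "0 < s'" "b \<le> decr_rearr f s'"
  obtains r where "0 < r" "a < decr_rearr f r" "decr_rearr f r < b"
proof -
  have meas: "f \<in> borel_measurable lebesgue"
    using rearr by (simp add: rearrangeable_def)
  define m where "m = (a + b) / 2"
  have m: "a < m" "m < b" "0 \<le> m"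
    using assms by (auto simp: m_def)
  have le: "distribution_fun f a \<le> ennreal s"
    using less_decr_rearr_iff[OF rearr \<open>0 < s\<close> \<open>0 \<le> a\<close>] \<open>decr_rearr f s \<le> a\<close> by (simp flip: not_less)
  have "ennreal s' < distribution_fun f a"
    using less_decr_rearr_iff[OF rearr \<open>0 < s'\<close> \<open>0 \<le> a\<close>] assms by simp
  then have lt: "distribution_fun f m < distribution_fun f a"
    using le by (intro VMO_no_level_gap[OF \<S> dens f meas nonneg m(1)]) (auto intro: le_less_trans)
  then have "distribution_fun f m < \<infinity>" by (simp add: order.strict_trans2)
  have "ennreal s' < distribution_fun f m"
    using less_decr_rearr_iff[OF rearr \<open>0 < s'\<close> m(3)] assms m by simp
  then obtain r where r: "distribution_fun f m = ennreal r" "s' < r"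
    using \<open>distribution_fun f m < \<infinity>\<close> \<open>0 < s'\<close> by (cases "distribution_fun f m") (auto simp: ennreal_less_iff)
  show thesis
  proof (rule that[of r])
    show "0 < r" using r \<open>0 < s'\<close> by simp
    then show "a < decr_rearr f r"
      using less_decr_rearr_iff[OF rearr _ \<open>0 \<le> a\<close>] lt r by simp
    have "\<not> m < decr_rearr f r"
      using less_decr_rearr_iff[OF rearr \<open>0 < r\<close> m(3)] r by simp
    then show "decr_rearr f r < b" using m by simp
  qed
qed

text \<open>A Dini-type argument on a grid of levels with spacing \<open>e\<close>. In each cell
  that \<open>h\<close> passes, some \<open>h r\<close> lies strictly inside. A lower bound for
  \<open>H k\<close> at these finitely many points \<open>r\<close> spreads to all smaller arguments
  because \<open>H k\<close> decreases; at most two cells are lost.\<close>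

lemma clamp_uniform_limit:
  fixes h :: "real \<Rightarrow> real" and H :: "nat \<Rightarrow> real \<Rightarrow> real"
  assumes H: "\<And>k s s'. 0 < s \<Longrightarrow> s \<le> s' \<Longrightarrow> H k s' \<le> H k s"
    and h: "\<And>s s'. 0 < s \<Longrightarrow> s \<le> s' \<Longrightarrow> h s' \<le> h s"
    and lim: "\<And>s v. 0 < s \<Longrightarrow> L \<le> v \<Longrightarrow> v < h s \<Longrightarrow> \<forall>\<^sub>F k in sequentially. v < H k s"
    and gap: "\<And>a b s'. L < a \<Longrightarrow> a < b \<Longrightarrow> 0 < s' \<Longrightarrow> b \<le> h s' \<Longrightarrow> \<exists>r>0. a < h r \<and> h r < b"
    and "L \<le> t" "0 < e"
  shows "\<forall>\<^sub>F k in sequentially. \<forall>s>0. max L (min t (h s)) - 2 * e \<le> max L (min t (H k s))"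
proof -
  define v where "v j = L + real j * e" for j
  obtain m :: nat where m: "(t - L) / e \<le> real m"
    using real_arch_simple by blast
  \<comment> \<open>Levels that \<open>h\<close> never reaches are vacuous. The cell
    \<open>j = 0\<close> is left out since \<open>gap\<close> asks for a lower end strictly above
    \<open>L\<close>.\<close>
  have "\<forall>\<^sub>F k in sequentially. (\<exists>s'>0. v (Suc j) \<le> h s') \<longrightarrow> (\<exists>r>0. h r < v (Suc j) \<and> v j < H k r)"
    if "0 < j" for j
  proof (cases "\<exists>s'>0. v (Suc j) \<le> h s'")
    case True
    have "L < v j" "v j < v (Suc j)"
      using \<open>0 < e\<close> that by (auto simp: v_def algebra_simps)
    then obtain r where r: "0 < r" "v j < h r" "h r < v (Suc j)"
      using gap True by blast
    have "\<forall>\<^sub>F k in sequentially. v j < H k r"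
      using r \<open>L < v j\<close> by (intro lim) auto
    then show ?thesis
      by eventually_elim (use r in blast)
  qed auto
  then have "\<forall>\<^sub>F k in sequentially. \<forall>j\<in>{1..m}.
      (\<exists>s'>0. v (Suc j) \<le> h s') \<longrightarrow> (\<exists>r>0. h r < v (Suc j) \<and> v j < H k r)"
    by (intro eventually_ball_finite) auto
  then show ?thesis
  proof eventually_elim
    case (elim k)
    show ?case
    proof (intro allI impI)
      fix s :: real
      assume "0 < s"
      define x where "x = max L (min t (h s))"
      have x: "L \<le> x" "x \<le> t" using \<open>L \<le> t\<close> by (auto simp: x_def)
      define j where "j = nat \<lfloor>(x - L) / e\<rfloor>"
      have "real j \<le> (x - L) / e" "(x - L) / e < real j + 1"
        using x \<open>0 < e\<close> by (auto simp: j_def)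
      then have j: "v j \<le> x" "x < v (Suc j)" "real j \<le> (t - L) / e"
        using \<open>0 < e\<close> x by (auto simp: v_def field_simps)
      \<comment> \<open>In the two lowest cells the bound is trivial, as a clamped value is at least
        \<open>L\<close>.\<close>
      show "max L (min t (h s)) - 2 * e \<le> max L (min t (H k s))"
      proof (cases "j \<le> 1")
        case True
        then have "v (Suc j) \<le> L + 2 * e"
          using \<open>0 < e\<close> by (auto simp: v_def)
        then show ?thesis using j by (simp add: x_def[symmetric])
      next
        case False
        then obtain i where i: "j = Suc i" "1 \<le> i"
          by (cases j) auto
        have "L < v j" using False \<open>0 < e\<close> by (simp add: v_def)
        then have "x \<le> h s" using j(1) by (auto simp: x_def max_def split: if_splits)
        then have "v (Suc i) \<le> h s" using j(1) i by simp
        moreover have "i \<in> {1..m}" using i j(3) m by auto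
        ultimately obtain r where r: "0 < r" "h r < v (Suc i)" "v i < H k r"
          using elim \<open>0 < s\<close> by blast
        \<comment> \<open>\<open>h\<close> is at least \<open>v (Suc i)\<close> at \<open>s\<close>
          and below it at \<open>r\<close>.\<close>
        have "s \<le> r"
          using h[OF r(1), of s] r(2) \<open>v (Suc i) \<le> h s\<close> by linarith
        then have "v i < H k s"
          using H[OF \<open>0 < s\<close>, of r k] r(3) by linarith
        moreover have "x - 2 * e \<le> v i"
          using j(2) i by (simp add: v_def algebra_simps)
        moreover have "x - 2 * e \<le> t" using x \<open>0 < e\<close> by simp
        ultimately show ?thesis by (simp add: x_def[symmetric] le_max_iff_disj)
      qed
    qed
  qed
qed

subsection \<open>Radial functions\<close>

text \<open>The volume of the centred ball with \<open>x\<close> on its boundary, where the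
  symmetric rearrangement evaluates \<open>f\<^sup>*\<close>. In this coordinate radial integration
  has constant density.\<close>

definition radial_vol :: "'a::euclidean_space \<Rightarrow> real" where
  "radial_vol x = measure lebesgue (ball (0::'a) 1) * norm x ^ DIM('a)"

lemma radial_vol_measurable [measurable]: "radial_vol \<in> borel_measurable borel"
  unfolding radial_vol_def by measurable

lemma unit_ball_measure_pos: "0 < measure lebesgue (ball (0::'a::euclidean_space) 1)"
  using content_ball_pos[of 1 "0::'a"] by simp

text \<open>Dilation by \<open>R\<close> maps the unit part of the cone onto the part of radius
  \<open>R\<close>. For \<open>R = 0\<close> at most the origin is left, a null set.\<close>

lemma cone_Int_cball:
  fixes K :: "'a::euclidean_space set"
  assumes K: "K \<in> sets borel" and cone: "\<And>x t. x \<in> K \<Longrightarrow> 0 < t \<Longrightarrow> t *\<^sub>R x \<in> K" and "0 \<le> R"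
  shows "measure lborel (K \<inter> cball 0 R) = R ^ DIM('a) * measure lborel (K \<inter> cball 0 1)"
proof (cases "R = 0")
  case True
  have "emeasure lborel (K \<inter> {0}) \<le> emeasure lborel {0::'a}"
    by (rule emeasure_mono) auto
  then show ?thesis using True by (simp add: measure_def)
next
  case False
  then have R: "0 < R" using \<open>0 \<le> R\<close> by simp
  have "(\<lambda>x. R *\<^sub>R x + 0) ` (K \<inter> cball 0 1) = K \<inter> cball 0 R"
  proof (intro set_eqI iffI)
    fix y assume y: "y \<in> K \<inter> cball 0 R"
    then have "(1 / R) *\<^sub>R y \<in> K \<inter> cball 0 1"
      using cone[of y "1 / R"] R by (auto simp: field_simps)
    then show "y \<in> (\<lambda>x. R *\<^sub>R x + 0) ` (K \<inter> cball 0 1)"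
      using R by (intro image_eqI[of _ _ "(1 / R) *\<^sub>R y"]) auto
  qed (use R cone mult_left_le[of _ R] in auto)
  moreover have "K \<inter> cball 0 r \<in> sets borel" for r
    using K by auto
  ultimately show ?thesis
    using measure_lebesgue_affine[of R 0 "K \<inter> cball 0 1"] R by simp
qed

text \<open>Dilations act transitively on the spheres inside a cone, so on the cone \<^term>\<open>radial_vol\<close>
  pushes Lebesgue measure forward to a multiple of Lebesgue measure on the half line.\<close>

lemma cone_annulus:
  fixes K :: "'a::euclidean_space set"
  assumes K: "K \<in> sets borel" and cone: "\<And>x t. x \<in> K \<Longrightarrow> 0 < t \<Longrightarrow> t *\<^sub>R x \<in> K" and "0 \<le> a" "a \<le> b"
  shows "emeasure lborel (K \<inter> {x. a < radial_vol x \<and> radial_vol x \<le> b}) =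
    ennreal (measure lborel (K \<inter> cball 0 1) / measure lebesgue (ball (0::'a) 1) * (b - a))"
proof -
  let ?\<omega> = "measure lebesgue (ball (0::'a) 1)"
  have \<omega>: "0 < ?\<omega>" by (rule unit_ball_measure_pos)
  \<comment> \<open>The radius of the ball of volume \<open>s\<close>.\<close>
  define \<rho> where "\<rho> s = root DIM('a) (s / ?\<omega>)" for s
  have \<rho>: "0 \<le> \<rho> s" "\<rho> s ^ DIM('a) = s / ?\<omega>" if "0 \<le> s" for s
    using that \<omega> by (auto simp: \<rho>_def)
  have le_iff: "radial_vol x \<le> s \<longleftrightarrow> norm x \<le> \<rho> s" if "0 \<le> s" for x :: 'a and s
  proof -
    have "radial_vol x \<le> s \<longleftrightarrow> norm x ^ DIM('a) \<le> \<rho> s ^ DIM('a)"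
      using \<omega> by (simp add: \<rho>(2)[OF that] radial_vol_def field_simps)
    also have "\<dots> \<longleftrightarrow> norm x \<le> \<rho> s"
      using \<rho>(1)[OF that] by (intro power_mono_iff) auto
    finally show ?thesis .
  qed
  have sets: "K \<inter> cball 0 r \<in> fmeasurable lborel" for r
  proof (rule fmeasurableI)
    have "emeasure lborel (K \<inter> cball 0 r) \<le> emeasure lborel (cball (0::'a) r)"
      by (rule emeasure_mono) auto
    then show "emeasure lborel (K \<inter> cball 0 r) < \<infinity>"
      using emeasure_lborel_cball_finite by (rule order.strict_trans1)
  qed (use K in auto)
  have eq: "K \<inter> {x. a < radial_vol x \<and> radial_vol x \<le> b} = (K \<inter> cball 0 (\<rho> b)) - (K \<inter> cball 0 (\<rho> a))"
    using le_iff[of a] le_iff[of b] \<open>0 \<le> a\<close> \<open>a \<le> b\<close> by (auto simp: not_le[symmetric])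
  have sub: "K \<inter> cball 0 (\<rho> a) \<subseteq> K \<inter> cball 0 (\<rho> b)"
    using le_iff[of a] le_iff[of b] \<open>0 \<le> a\<close> \<open>a \<le> b\<close> by (fastforce dest: order_trans)
  have "measure lborel (K \<inter> {x. a < radial_vol x \<and> radial_vol x \<le> b}) =
      measure lborel (K \<inter> cball 0 (\<rho> b)) - measure lborel (K \<inter> cball 0 (\<rho> a))"
    unfolding eq by (rule measurable_measure_Diff[OF sets fmeasurableD[OF sets] sub])
  also have "\<dots> = measure lborel (K \<inter> cball 0 1) / ?\<omega> * (b - a)"
  proof -
    have "measure lborel (K \<inter> cball 0 (\<rho> s)) = s / ?\<omega> * measure lborel (K \<inter> cball 0 1)" if "0 \<le> s" for s
      unfolding \<rho>(2)[OF that, symmetric] by (rule cone_Int_cball[OF K cone \<rho>(1)[OF that]])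
    from this[of a] this[of b] show ?thesis
      using \<open>0 \<le> a\<close> \<open>a \<le> b\<close> by (simp add: algebra_simps diff_divide_distrib)
  qed
  finally have meas: "measure lborel (K \<inter> {x. a < radial_vol x \<and> radial_vol x \<le> b}) = \<dots>" .
  have "K \<inter> {x. a < radial_vol x \<and> radial_vol x \<le> b} \<in> fmeasurable lborel"
    unfolding eq by (rule fmeasurable.Diff[OF sets sets])
  then have "emeasure lborel (K \<inter> {x. a < radial_vol x \<and> radial_vol x \<le> b}) =
      ennreal (measure lborel (K \<inter> {x. a < radial_vol x \<and> radial_vol x \<le> b}))"
    by (rule emeasure_eq_measure2)
  then show ?thesis
    by (simp only: meas)
qed

text \<open>Both sides integrate \<open>h\<close> against a measure on the line, and the two
  measures are identified by their finite values on right half-lines. Clipping \<open>x\<close> to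
  the range from \<open>a\<close> to \<open>b\<close> makes the preimage of each half-line an
  annular sector of known measure.\<close>

lemma cone_nn_integral_radial:
  fixes K :: "'a::euclidean_space set"
  assumes K: "K \<in> sets borel" and cone: "\<And>x t. x \<in> K \<Longrightarrow> 0 < t \<Longrightarrow> t *\<^sub>R x \<in> K" and "0 \<le> a" "a \<le> b"
    and [measurable]: "h \<in> borel_measurable borel"
  shows "(\<integral>\<^sup>+ x. indicator (K \<inter> {x. a < radial_vol x \<and> radial_vol x \<le> b}) x * h (radial_vol x) \<partial>lborel) =
    ennreal (measure lborel (K \<inter> cball 0 1) / measure lebesgue (ball (0::'a) 1)) *
      (\<integral>\<^sup>+ s. indicator {a<..b} s * h s \<partial>lborel)"
proof -
  define \<theta> where "\<theta> = measure lborel (K \<inter> cball 0 1) / measure lebesgue (ball (0::'a) 1)"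
  have \<theta>: "0 \<le> \<theta>" by (simp add: \<theta>_def)
  let ?A = "K \<inter> {x. a < radial_vol x \<and> radial_vol x \<le> b}"
  have [measurable]: "?A \<in> sets borel"
    using K by measurable
  define M where "M = distr (density lborel (indicator ?A)) borel radial_vol"
  define N where "N = density lborel (\<lambda>s. ennreal \<theta> * indicator {a<..b} s)"
  have ann: "emeasure lborel (K \<inter> {x. c < radial_vol x \<and> radial_vol x \<le> b}) = ennreal (\<theta> * (b - c))"
    if "0 \<le> c" "c \<le> b" for c
    unfolding \<theta>_def by (rule cone_annulus[OF K cone that])
  have emM: "emeasure M {x<..} = ennreal (\<theta> * (b - min b (max a x)))" for x
  proof -
    have "emeasure M {x<..} = emeasure lborel (K \<inter> {y. min b (max a x) < radial_vol y \<and> radial_vol y \<le> b})"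
    proof -
      have [measurable]: "radial_vol -` {x<..} \<in> sets (borel :: 'a measure)"
        using measurable_sets[OF radial_vol_measurable, of "{x<..}"] by simp
      have "emeasure M {x<..} = (\<integral>\<^sup>+ y. indicator ?A y * indicator (radial_vol -` {x<..}) y \<partial>lborel)"
        by (simp add: M_def emeasure_distr emeasure_density)
      also have "\<dots> = (\<integral>\<^sup>+ y. indicator (K \<inter> {y. min b (max a x) < radial_vol y \<and> radial_vol y \<le> b}) y \<partial>lborel)"
        using \<open>a \<le> b\<close> by (intro nn_integral_cong) (auto simp: indicator_def)
      also have "\<dots> = emeasure lborel (K \<inter> {y. min b (max a x) < radial_vol y \<and> radial_vol y \<le> b})"
      proof -
        have "K \<inter> {y. min b (max a x) < radial_vol y \<and> radial_vol y \<le> b} \<in> sets borel"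
          using K by measurable
        then show ?thesis by (intro nn_integral_indicator) simp
      qed
      finally show ?thesis .
    qed
    also have "\<dots> = ennreal (\<theta> * (b - min b (max a x)))"
      using assms by (intro ann) auto
    finally show ?thesis .
  qed
  have emN: "emeasure N {x<..} = ennreal (\<theta> * (b - min b (max a x)))" for x
  proof -
    have "emeasure N {x<..} = (\<integral>\<^sup>+ s. ennreal \<theta> * indicator {min b (max a x)<..b} s \<partial>lborel)"
      unfolding N_def using \<open>a \<le> b\<close>
      by (subst emeasure_density, measurable) (intro nn_integral_cong, auto simp: indicator_def)
    also have "\<dots> = ennreal \<theta> * ennreal (b - min b (max a x))"
      by (simp add: nn_integral_cmult)
    finally show ?thesis
      using \<theta> by (simp add: ennreal_mult)
  qed
  have "M = N"
    by (rule measure_eqI_lessThan) (auto simp: emM emN, auto simp: M_def N_def)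
  then have "(\<integral>\<^sup>+ s. h s \<partial>M) = (\<integral>\<^sup>+ s. h s \<partial>N)"
    by simp
  also have "(\<integral>\<^sup>+ s. h s \<partial>M) = (\<integral>\<^sup>+ x. indicator ?A x * h (radial_vol x) \<partial>lborel)"
    unfolding M_def by (simp add: nn_integral_distr nn_integral_density)
  also have "(\<integral>\<^sup>+ s. h s \<partial>N) = ennreal \<theta> * (\<integral>\<^sup>+ s. indicator {a<..b} s * h s \<partial>lborel)"
    unfolding N_def by (simp add: nn_integral_density nn_integral_cmult mult.assoc)
  finally show ?thesis
    by (simp add: \<theta>_def)
qed

text \<open>The set is contained in an annular sector of comparable size: the part of the cone over it
  that lies in the spherical shell of thickness at most \<open>2D\<close> around it.\<close>

lemma nn_integral_radial_le:
  fixes a :: "'a::euclidean_space"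
  assumes "open Q" "Q \<subseteq> ball a D" "0 < D"
  obtains s\<^sub>0 s\<^sub>1 \<theta> where "0 \<le> s\<^sub>0" "s\<^sub>0 < s\<^sub>1" "0 \<le> \<theta>" "\<theta> * (s\<^sub>1 - s\<^sub>0) \<le> measure lborel (cball a (3 * D))"
    "\<forall>h\<in>borel_measurable borel.
      (\<integral>\<^sup>+ x. indicator Q x * h (radial_vol x) \<partial>lborel) \<le> ennreal \<theta> * (\<integral>\<^sup>+ s. indicator {s\<^sub>0<..<s\<^sub>1} s * h s \<partial>lborel)"
proof -
  let ?\<omega> = "measure lebesgue (ball (0::'a) 1)"
  have \<omega>: "0 < ?\<omega>" by (rule unit_ball_measure_pos)
  define K where "K = (\<Union>t\<in>{0<..}. (\<lambda>x. t *\<^sub>R x) ` Q)"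
  have "open K"
    unfolding K_def using \<open>open Q\<close> by (intro open_UN ballI open_scaling) auto
  then have K: "K \<in> sets borel" by simp
  have cone: "t *\<^sub>R x \<in> K" if "x \<in> K" "0 < t" for x t
    using that by (force simp: K_def)
  have QK: "Q \<subseteq> K"
    unfolding K_def by (intro subsetI UN_I[of 1]) auto
  \<comment> \<open>Bounds for the norm on the ball around \<open>a\<close>; the maximum covers
    balls containing the origin.\<close>
  define r\<^sub>0 where "r\<^sub>0 = max 0 (norm a - D)"
  define r\<^sub>1 where "r\<^sub>1 = norm a + D"
  have r: "0 \<le> r\<^sub>0" "r\<^sub>0 < r\<^sub>1" "r\<^sub>1 - r\<^sub>0 \<le> 2 * D"
    using \<open>0 < D\<close> by (auto simp: r\<^sub>0_def r\<^sub>1_def) (smt (verit) norm_ge_zero)+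
  define s\<^sub>0 where "s\<^sub>0 = ?\<omega> * r\<^sub>0 ^ DIM('a)"
  define s\<^sub>1 where "s\<^sub>1 = ?\<omega> * r\<^sub>1 ^ DIM('a)"
  define \<theta> where "\<theta> = measure lborel (K \<inter> cball 0 1) / ?\<omega>"
  have s: "0 \<le> s\<^sub>0" "s\<^sub>0 < s\<^sub>1" "0 \<le> \<theta>"
    using r \<omega> by (auto simp: s\<^sub>0_def s\<^sub>1_def \<theta>_def intro!: power_strict_mono)
  have gt: "s\<^sub>0 < radial_vol x \<longleftrightarrow> r\<^sub>0 < norm x" for x :: 'a
    using \<omega> r by (simp add: s\<^sub>0_def radial_vol_def power_mono_iff flip: not_le)
  have le: "radial_vol x \<le> s\<^sub>1 \<longleftrightarrow> norm x \<le> r\<^sub>1" for x :: 'a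
    using \<omega> r by (simp add: s\<^sub>1_def radial_vol_def power_mono_iff)
  have Q: "r\<^sub>0 < norm x \<and> norm x < r\<^sub>1" if "x \<in> Q" "x \<noteq> 0" for x
  proof -
    have "norm (x - a) < D"
      using assms that by (auto simp: dist_norm norm_minus_commute)
    then show ?thesis
      using norm_triangle_ineq3[of x a] that by (auto simp: r\<^sub>0_def r\<^sub>1_def)
  qed
  let ?A = "K \<inter> {x. s\<^sub>0 < radial_vol x \<and> radial_vol x \<le> s\<^sub>1}"
  \<comment> \<open>Each \<open>x\<close> shares a ray with some \<open>y\<close> in
    \<open>Q\<close>, so their distance is the difference of their norms, at most
    \<open>2 * D\<close>. The distance from \<open>y\<close> to \<open>a\<close> adds another
    \<open>D\<close>.\<close>
  have "?A \<subseteq> cball a (3 * D)"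
  proof
    fix x assume x: "x \<in> ?A"
    then obtain t y where ty: "0 < t" "y \<in> Q" "x = t *\<^sub>R y"
      by (auto simp: K_def)
    have nx: "r\<^sub>0 < norm x" "norm x \<le> r\<^sub>1"
      using x gt le by auto
    then have "y \<noteq> 0" using ty r by auto
    have "x - y = (t - 1) *\<^sub>R y" using ty by (simp add: algebra_simps)
    then have "norm (x - y) = \<bar>t - 1\<bar> * norm y" by simp
    also have "\<dots> = \<bar>(t - 1) * norm y\<bar>"
      by (simp add: abs_mult)
    also have "\<dots> = \<bar>norm x - norm y\<bar>"
      using ty(1,3) by (simp add: left_diff_distrib)
    also have "\<dots> \<le> 2 * D"
      using nx Q[OF ty(2) \<open>y \<noteq> 0\<close>] r by linarith
    finally have "dist x y \<le> 2 * D" by (simp add: dist_norm)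
    moreover have "dist a y < D" using assms ty by auto
    ultimately show "x \<in> cball a (3 * D)"
      using dist_triangle[of a x y] by (auto simp: dist_commute)
  qed
  then have "emeasure lborel ?A \<le> emeasure lborel (cball a (3 * D))"
    by (rule emeasure_mono) simp
  moreover have "emeasure lborel ?A = ennreal (\<theta> * (s\<^sub>1 - s\<^sub>0))"
    unfolding \<theta>_def by (rule cone_annulus[OF K cone s(1) less_imp_le[OF s(2)]])
  moreover have "emeasure lborel (cball a (3 * D)) = ennreal (measure lborel (cball a (3 * D)))"
    using emeasure_lborel_cball_finite[of a "3 * D"] by (intro emeasure_eq_ennreal_measure) auto
  ultimately have "ennreal (\<theta> * (s\<^sub>1 - s\<^sub>0)) \<le> ennreal (measure lborel (cball a (3 * D)))"
    by (simp only:)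
  then have size: "\<theta> * (s\<^sub>1 - s\<^sub>0) \<le> measure lborel (cball a (3 * D))"
    by (simp add: ennreal_le_iff)
  show thesis
  proof (rule that[OF s size], rule ballI)
    fix h :: "real \<Rightarrow> ennreal"
    assume [measurable]: "h \<in> borel_measurable borel"
    have "(\<integral>\<^sup>+ x. indicator Q x * h (radial_vol x) \<partial>lborel) \<le> (\<integral>\<^sup>+ x. indicator ?A x * h (radial_vol x) \<partial>lborel)"
    proof (rule nn_integral_mono_AE)
      \<comment> \<open>If \<open>Q\<close> contains the origin, then \<open>r\<^sub>0 = 0\<close>
        and the sector misses exactly this point of it.\<close>
      have "AE x in lborel. x \<noteq> (0::'a)"
        by (rule AE_lborel_singleton)
      then show "AE x in lborel. indicator Q x * h (radial_vol x) \<le> indicator ?A x * h (radial_vol x)"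
        by eventually_elim (use Q QK gt le in \<open>auto simp: indicator_def less_imp_le\<close>)
    qed
    also have "\<dots> = ennreal \<theta> * (\<integral>\<^sup>+ s. indicator {s\<^sub>0<..s\<^sub>1} s * h s \<partial>lborel)"
      unfolding \<theta>_def by (rule cone_nn_integral_radial[OF K cone]) (use s in auto)
    \<comment> \<open>The members of \<open>pos_intervals\<close> are open, so the endpoint is
      dropped.\<close>
    also have "(\<integral>\<^sup>+ s. indicator {s\<^sub>0<..s\<^sub>1} s * h s \<partial>lborel) = (\<integral>\<^sup>+ s. indicator {s\<^sub>0<..<s\<^sub>1} s * h s \<partial>lborel)"
    proof (rule nn_integral_cong_AE)
      have "AE s in lborel. s \<noteq> s\<^sub>1"
        by (rule AE_lborel_singleton)
      then show "AE s in lborel. indicator {s\<^sub>0<..s\<^sub>1} s * h s = indicator {s\<^sub>0<..<s\<^sub>1} s * h s"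
        by eventually_elim (auto simp: indicator_def)
    qed
    finally show "(\<integral>\<^sup>+ x. indicator Q x * h (radial_vol x) \<partial>lborel) \<le>
        ennreal \<theta> * (\<integral>\<^sup>+ s. indicator {s\<^sub>0<..<s\<^sub>1} s * h s \<partial>lborel)" .
  qed
qed

text \<open>The comparison constant on \<open>Q\<close> is the mean of \<open>g\<close> over the
  interval attached to \<open>Q\<close>. Passing to the sector only increases the integral, and the
  measure of the sector is at most that of the larger ball; the quotient of measures is the
  cost.\<close>

lemma mean_osc_radial_le:
  fixes a :: "'a::euclidean_space"
  assumes Q: "open Q" "Q \<subseteq> ball a D" "0 < D" "0 < measure lebesgue Q"
    and [measurable]: "g \<in> borel_measurable borel"
    and g: "\<And>I. I \<in> pos_intervals \<Longrightarrow> set_integrable lebesgue I g"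
    and osc: "\<And>I. I \<in> pos_intervals \<Longrightarrow> mean_osc g I \<le> B"
  shows "set_integrable lebesgue Q (\<lambda>x. g (radial_vol x))"
    and "mean_osc (\<lambda>x. g (radial_vol x)) Q \<le> 2 * (measure lborel (cball a (3 * D)) / measure lebesgue Q) * B"
proof -
  obtain s\<^sub>0 s\<^sub>1 \<theta> where s: "0 \<le> s\<^sub>0" "s\<^sub>0 < s\<^sub>1" "0 \<le> \<theta>" "\<theta> * (s\<^sub>1 - s\<^sub>0) \<le> measure lborel (cball a (3 * D))"
    and le: "\<forall>h\<in>borel_measurable borel.
      (\<integral>\<^sup>+ x. indicator Q x * h (radial_vol x) \<partial>lborel) \<le> ennreal \<theta> * (\<integral>\<^sup>+ s. indicator {s\<^sub>0<..<s\<^sub>1} s * h s \<partial>lborel)"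
    by (rule nn_integral_radial_le[OF Q(1-3)]) blast
  have [measurable]: "Q \<in> sets borel" using Q by simp
  have Qm: "Q \<in> lmeasurable"
    using Q by (intro lmeasurable_open) (auto intro: bounded_subset[OF bounded_ball])
  let ?I = "{s\<^sub>0<..<s\<^sub>1}"
  have I: "?I \<in> pos_intervals"
    using s by (auto simp: pos_intervals_def)
  define c where "c = mean_value g ?I"
  have int_I: "set_integrable lebesgue ?I (\<lambda>s. \<bar>g s - k\<bar>)" for k
    using g[OF I] by (intro set_integrable_abs set_integral_diff(1) set_integrable_const_lmeasurable) auto
  have nn: "(\<integral>\<^sup>+ x. ennreal (indicator Q x *\<^sub>R \<bar>g (radial_vol x) - k\<bar>) \<partial>lebesgue)
      \<le> ennreal (\<theta> * (LINT s:?I|lebesgue. \<bar>g s - k\<bar>))" for k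
  proof -
    have "(\<integral>\<^sup>+ x. ennreal (indicator Q x *\<^sub>R \<bar>g (radial_vol x) - k\<bar>) \<partial>lebesgue) =
        (\<integral>\<^sup>+ x. indicator Q x * ennreal \<bar>g (radial_vol x) - k\<bar> \<partial>lborel)"
      unfolding nn_integral_completion by (intro nn_integral_cong) (auto simp: indicator_def)
    also have "\<dots> \<le> ennreal \<theta> * (\<integral>\<^sup>+ s. indicator ?I s * ennreal \<bar>g s - k\<bar> \<partial>lborel)"
      by (rule le[rule_format]) measurable
    also have "(\<integral>\<^sup>+ s. indicator ?I s * ennreal \<bar>g s - k\<bar> \<partial>lborel) =
        (\<integral>\<^sup>+ s. ennreal (indicator ?I s *\<^sub>R \<bar>g s - k\<bar>) \<partial>lebesgue)"
      unfolding nn_integral_completion by (intro nn_integral_cong) (auto simp: indicator_def)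
    also have "\<dots> = ennreal (LINT s:?I|lebesgue. \<bar>g s - k\<bar>)"
      unfolding set_lebesgue_integral_def using int_I[of k]
      by (intro nn_integral_eq_integral) (auto simp: set_integrable_def)
    finally show ?thesis
      using s by (simp add: ennreal_mult')
  qed
  have int_Q: "set_integrable lebesgue Q (\<lambda>x. \<bar>g (radial_vol x) - k\<bar>)" for k
    unfolding set_integrable_def
  proof (rule integrableI_nonneg)
    have "(\<lambda>x. indicator Q x *\<^sub>R \<bar>g (radial_vol x) - k\<bar>) \<in> borel_measurable borel"
      by measurable
    then show "(\<lambda>x. indicator Q x *\<^sub>R \<bar>g (radial_vol x) - k\<bar>) \<in> borel_measurable lebesgue"
      by (intro measurable_completion) simp
    show "(\<integral>\<^sup>+ x. ennreal (indicator Q x *\<^sub>R \<bar>g (radial_vol x) - k\<bar>) \<partial>lebesgue) < \<infinity>"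
      by (rule le_less_trans[OF nn]) simp
  qed (simp add: indicator_def)
  have "(\<lambda>x. indicator Q x *\<^sub>R g (radial_vol x)) \<in> borel_measurable borel"
    by measurable
  then have "set_borel_measurable lebesgue Q (\<lambda>x. g (radial_vol x))"
    unfolding set_borel_measurable_def by (intro measurable_completion) simp
  then show int: "set_integrable lebesgue Q (\<lambda>x. g (radial_vol x))"
    by (intro set_integrable_bound[OF int_Q[of 0]]) auto
  have "ennreal (LINT x:Q|lebesgue. \<bar>g (radial_vol x) - c\<bar>) =
      (\<integral>\<^sup>+ x. ennreal (indicator Q x *\<^sub>R \<bar>g (radial_vol x) - c\<bar>) \<partial>lebesgue)"
    unfolding set_lebesgue_integral_def using int_Q[of c]
    by (intro nn_integral_eq_integral[symmetric]) (auto simp: set_integrable_def)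
  also note nn
  finally have "(LINT x:Q|lebesgue. \<bar>g (radial_vol x) - c\<bar>) \<le> \<theta> * (LINT s:?I|lebesgue. \<bar>g s - c\<bar>)"
    using s by (subst (asm) ennreal_le_iff) (auto simp: set_lebesgue_integral_def)
  also have "\<dots> = \<theta> * (s\<^sub>1 - s\<^sub>0) * mean_osc g ?I"
    using s by (simp add: mean_osc_def c_def)
  also have "\<dots> \<le> measure lborel (cball a (3 * D)) * mean_osc g ?I"
    by (rule mult_right_mono[OF s(4) mean_osc_nonneg])
  also have "\<dots> \<le> measure lborel (cball a (3 * D)) * B"
    by (rule mult_left_mono[OF osc[OF I]]) simp
  finally have "2 * (LINT x:Q|lebesgue. \<bar>g (radial_vol x) - c\<bar>) / measure lebesgue Q \<le>
      2 * (measure lborel (cball a (3 * D)) * B) / measure lebesgue Q"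
    using Q(4) by (intro divide_right_mono) auto
  then show "mean_osc (\<lambda>x. g (radial_vol x)) Q \<le>
      2 * (measure lborel (cball a (3 * D)) / measure lebesgue Q) * B"
    using mean_osc_le[OF int Qm, of c] by (simp add: mult.assoc)
qed

lemma mean_osc_radial_cube_le:
  obtains C :: real where "0 \<le> C"
    "\<And>g B Q. g \<in> borel_measurable borel \<Longrightarrow> (\<And>I. I \<in> pos_intervals \<Longrightarrow> set_integrable lebesgue I g) \<Longrightarrow>
      (\<And>I. I \<in> pos_intervals \<Longrightarrow> mean_osc g I \<le> B) \<Longrightarrow> (Q :: (real ^ 'n) set) \<in> cubes \<Longrightarrow>
      set_integrable lebesgue Q (\<lambda>x. g (radial_vol x)) \<and> mean_osc (\<lambda>x. g (radial_vol x)) Q \<le> C * B"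
proof -
  \<comment> \<open>A cube of side \<open>l\<close> lies in the ball of radius
    \<open>D = CARD('n) * l\<close> around its corner \<open>a\<close>, by the bound of the norm by
    the sum of coordinates. The quotient of the measures of \<open>cball a (3 * D)\<close> and the
    cube does not depend on \<open>l\<close>.\<close>
  define C where "C = 2 * (unit_ball_vol CARD('n) * (3 * real CARD('n)) ^ CARD('n))"
  show thesis
  proof (rule that[of C])
    show "0 \<le> C" by (simp add: C_def)
    fix g :: "real \<Rightarrow> real" and B and Q :: "(real ^ 'n) set"
    assume g: "g \<in> borel_measurable borel" "\<And>I. I \<in> pos_intervals \<Longrightarrow> set_integrable lebesgue I g"
      "\<And>I. I \<in> pos_intervals \<Longrightarrow> mean_osc g I \<le> B" and "Q \<in> cubes"
    then obtain a :: "real ^ 'n" and l where Q: "Q = box a (a + vec l)" "0 < l"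
      by (auto simp: cubes_def)
    define D where "D = real CARD('n) * l"
    have D: "0 < D" using Q by (simp add: D_def)
    have sub: "Q \<subseteq> ball a D"
    proof
      fix x assume x: "x \<in> Q"
      have "norm (x - a) \<le> (\<Sum>i\<in>UNIV. \<bar>(x - a) $ i\<bar>)"
        by (rule norm_le_l1_cart)
      also have "\<dots> < (\<Sum>i\<in>(UNIV::'n set). l)"
        using x by (intro sum_strict_mono) (auto simp: Q mem_box_cart, smt (verit))
      finally show "x \<in> ball a D"
        by (simp add: D_def dist_norm norm_minus_commute)
    qed
    have vol: "measure lebesgue Q = l ^ CARD('n)"
    proof -
      have "measure lebesgue Q = (\<Prod>b\<in>Basis. (vec l :: real ^ 'n) \<bullet> b)"
        using Q by (auto simp: measure_lborel_box_eq Basis_vec_def inner_axis algebra_simps)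
      also have "\<dots> = (\<Prod>b\<in>(Basis :: (real ^ 'n) set). l)"
        by (rule prod.cong) (auto simp: Basis_vec_def inner_axis)
      finally show ?thesis by simp
    qed
    have "2 * (measure lborel (cball a (3 * D)) / measure lebesgue Q) = C"
      using D Q(2) by (simp add: content_cball vol C_def D_def power_mult_distrib)
    then show "set_integrable lebesgue Q (\<lambda>x. g (radial_vol x)) \<and> mean_osc (\<lambda>x. g (radial_vol x)) Q \<le> C * B"
      using mean_osc_radial_le[OF _ sub D _ g] Q vol by (auto simp: open_box)
  qed
qed

subsection \<open>Convergence of rearrangements\<close>

text \<open>Identities between rearrangements are available only at positive arguments, so they are
  substituted on the interval at hand.\<close>

lemma mean_osc_cong:
  assumes "\<And>x. x \<in> S \<Longrightarrow> f x = g x"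
  shows "mean_osc f S = mean_osc g S"
proof -
  have cong: "set_lebesgue_integral lebesgue S u = set_lebesgue_integral lebesgue S v"
    if "\<And>x. x \<in> S \<Longrightarrow> u x = v x" for u v :: "'a \<Rightarrow> real"
    unfolding set_lebesgue_integral_def
    by (rule Bochner_Integration.integral_cong) (use that in \<open>auto simp: indicator_def\<close>)
  have mean: "mean_value f S = mean_value g S"
    unfolding mean_value_def using cong[of f g] assms by simp
  have "(LINT x:S|lebesgue. \<bar>f x - mean_value g S\<bar>) = (LINT x:S|lebesgue. \<bar>g x - mean_value g S\<bar>)"
    by (rule cong) (simp add: assms)
  then show ?thesis
    by (simp add: mean_osc_def mean)
qed

text \<open>Small shapes are controlled by vanishing mean oscillation, all others by the smallness of
  the total mass above level \<open>t\<close>.\<close>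

lemma VMO_truncate_small:
  assumes \<S>: "basis_of_shapes \<S>" and f: "f \<in> VMO \<S>" "rearrangeable f" "\<And>x. 0 \<le> f x"
    and int: "set_integrable lebesgue {0<..<1} (decr_rearr f)" and "0 < e"
  obtains t where "t\<^sub>0 \<le> t" "0 \<le> t"
    "\<And>g S. S \<in> \<S> \<Longrightarrow> set_integrable lebesgue S g \<Longrightarrow> (\<And>x. g x \<le> f x) \<Longrightarrow>
      mean_osc (\<lambda>x. g x - f x) S \<le> e \<Longrightarrow> mean_osc (\<lambda>x. max (g x - t) 0) S \<le> 4 * e"
proof -
  obtain \<delta> where \<delta>: "0 < \<delta>" "\<And>S. S \<in> \<S> \<Longrightarrow> measure lebesgue S \<le> \<delta> \<Longrightarrow> mean_osc f S \<le> e"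
    using VMO_small[OF f(1) \<open>0 < e\<close>] by blast
  obtain t where t: "t\<^sub>0 \<le> t" "0 \<le> t" "(\<integral>\<^sup>+ x. ennreal (f x - t) \<partial>lebesgue) < ennreal (e * \<delta> / 2)"
    by (rule nn_integral_truncate_small[OF f(2,3) int, of "ennreal (e * \<delta> / 2)" t\<^sub>0]) (use \<open>0 < e\<close> \<delta> in auto)
  show thesis
  proof (rule that[OF t(1,2)])
    fix g S
    assume S: "S \<in> \<S>" and g: "set_integrable lebesgue S g" "\<And>x. g x \<le> f x" "mean_osc (\<lambda>x. g x - f x) S \<le> e"
    have Sm: "S \<in> lmeasurable"
      by (rule basis_of_shapes_lmeasurable[OF \<S> S])
    have fS: "set_integrable lebesgue S f"
      using f S by (auto simp: VMO_def BMO_def)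
    have lip: "\<bar>max (x - t) 0 - max (y - t) 0\<bar> \<le> \<bar>x - y\<bar>" for x y :: real
      by (auto simp: max_def)
    show "mean_osc (\<lambda>x. max (g x - t) 0) S \<le> 4 * e"
    proof (cases "measure lebesgue S \<le> \<delta>")
      case True
      \<comment> \<open>Both summands are at most \<open>e\<close>, and truncation doubles their
        sum.\<close>
      have "mean_osc (\<lambda>x. f x + (g x - f x)) S \<le> mean_osc f S + mean_osc (\<lambda>x. g x - f x) S"
        by (rule mean_osc_add_le[OF fS set_integral_diff(1)[OF g(1) fS] Sm])
      then have "mean_osc g S \<le> 2 * e"
        using \<delta>(2)[OF S True] g(3) by simp
      then show ?thesis
        using mean_osc_lipschitz_comp[OF g(1) Sm lip] by linarith
    next
      case False
      have "mean_osc (\<lambda>x. max (g x - t) 0) S \<le> e"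
        by (rule mean_osc_truncate_le[OF set_integrable_lipschitz_comp[OF g(1) Sm lip] Sm g(2)])
          (use False \<delta> \<open>0 < e\<close> t in auto)
      then show ?thesis using \<open>0 < e\<close> by simp
    qed
  qed
qed

theorem corollary4p11:
  fixes \<S> :: "(real ^ 'n) set set"
    and f :: "real ^ 'n \<Rightarrow> real"
    and F :: "nat \<Rightarrow> real ^ 'n \<Rightarrow> real"
    and L :: real
  assumes "basis_of_shapes \<S>"
    and "density_condition \<S>"
    and "\<exists>c::real. \<forall>g :: real ^ 'n \<Rightarrow> real. rearrangeable g \<and> g \<in> BMO \<S> \<longrightarrow>
           decr_rearr g \<in> BMO pos_intervals \<and>
           bmo_seminorm pos_intervals (decr_rearr g) \<le> ennreal c * bmo_seminorm \<S> g"
    and "\<And>k. rearrangeable (F k)" and "\<And>k. F k \<in> BMO \<S>"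
    and "rearrangeable f" and "f \<in> BMO \<S>"
    and "L = (INF s\<in>{0<..}. decr_rearr f s)"
    and "f \<in> VMO \<S>"
    and "converges_in_BMO \<S> F f"
    and "\<And>k x. 0 \<le> F k x"
    and "\<And>x. incseq (\<lambda>k. F k x)"
    and "\<And>x. (\<lambda>k. F k x) \<longlonglongrightarrow> f x"
    and "converges_in_BMO pos_intervals (\<lambda>k s. max (L - decr_rearr (F k) s) 0) (\<lambda>s. 0)"
  shows "converges_in_BMO cubes (\<lambda>k. symm_rearr (F k)) (symm_rearr f)"
proof -
  obtain c :: real where c: "\<And>g :: real ^ 'n \<Rightarrow> real. rearrangeable g \<Longrightarrow> g \<in> BMO \<S> \<Longrightarrow>
      decr_rearr g \<in> BMO pos_intervals \<and>
      bmo_seminorm pos_intervals (decr_rearr g) \<le> ennreal c * bmo_seminorm \<S> g"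
    using assms(3) by blast
  \<comment> \<open>\<open>c\<close> may be negative, in which case \<open>ennreal c\<close> is
    0.\<close>
  define C where "C = max c 0"
  have C: "0 \<le> C" by (simp add: C_def)
  note \<S> = assms(1) and F_rearr = assms(4) and F_BMO = assms(5) and f_rearr = assms(6)
    and f_BMO = assms(7) and f_VMO = assms(9) and F_nonneg = assms(11) and F_inc = assms(12) and F_lim = assms(13)
  have F_le: "F k x \<le> f x" for k x
    by (rule incseq_le[OF F_inc F_lim])
  have f_nonneg: "0 \<le> f x" for x
    using F_nonneg[of 0 x] F_le[of 0 x] by linarith
  have S: "S \<in> lmeasurable" if "S \<in> \<S>" for S
    by (rule basis_of_shapes_lmeasurable[OF \<S> that])
  have F_int: "set_integrable lebesgue S (F k)" and f_int: "set_integrable lebesgue S f" if "S \<in> \<S>" for S k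
    using F_BMO f_BMO that by (auto simp: BMO_def)
  have I_lm: "I \<in> lmeasurable" if "I \<in> pos_intervals" for I
    using that by (auto simp: pos_intervals_def)
  have I_pos: "0 < s" if "I \<in> pos_intervals" "s \<in> I" for I s
    using that by (auto simp: pos_intervals_def)
  have rearr_int: "set_integrable lebesgue I (decr_rearr g)"
    if "rearrangeable g" "g \<in> BMO \<S>" "I \<in> pos_intervals" for g :: "real ^ 'n \<Rightarrow> real" and I
    using c[OF that(1,2)] that(3) by (auto simp: BMO_def)
  have rearr_osc: "mean_osc (decr_rearr g) I \<le> C * e"
    if g: "rearrangeable g" "g \<in> BMO \<S>" and "0 \<le> e" "\<And>S. S \<in> \<S> \<Longrightarrow> mean_osc g S \<le> e" and I: "I \<in> pos_intervals"
    for g :: "real ^ 'n \<Rightarrow> real" and I e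
  proof -
    have "bmo_seminorm pos_intervals (decr_rearr g) \<le> ennreal c * bmo_seminorm \<S> g"
      using c[OF g] by blast
    also have "\<dots> \<le> ennreal c * ennreal e"
      using that by (intro mult_left_mono) (auto simp: bmo_seminorm_le_iff)
    also have "\<dots> = ennreal (C * e)"
      using \<open>0 \<le> e\<close> by (cases "0 \<le> c") (auto simp: C_def ennreal_mult ennreal_neg max_def)
    finally show ?thesis
      using bmo_seminorm_le_iff[of "C * e" pos_intervals] C \<open>0 \<le> e\<close> I by simp
  qed
  have L_le: "L \<le> decr_rearr f s" if "0 < s" for s
    unfolding assms(8) using that decr_rearr_nonneg
    by (intro cINF_lower bdd_belowI2[of _ 0]) auto
  have "0 \<le> L"
    unfolding assms(8) using decr_rearr_nonneg by (intro cINF_greatest) auto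
  have L_less: "\<exists>s>0. decr_rearr f s < a" if "L < a" for a
  proof -
    have "(INF s\<in>{0<..}. decr_rearr f s) < a"
      using that assms(8) by simp
    then show ?thesis
      by (subst (asm) cINF_less_iff) (auto intro!: bdd_belowI2[of _ 0] decr_rearr_nonneg)
  qed
  have rearr_le: "decr_rearr (F k) s \<le> decr_rearr f s" if "0 < s" for k s
    by (rule decr_rearr_mono_fun[OF F_rearr f_rearr that]) (use F_nonneg F_le f_nonneg in auto)
  have main: "\<forall>\<^sub>F k in sequentially. \<forall>I\<in>pos_intervals.
      mean_osc (\<lambda>s. decr_rearr (F k) s - decr_rearr f s) I \<le> e" if "0 < e" for e
  proof -
    \<comment> \<open>Each of the two parts above \<open>t\<close> costs \<open>4 * C * d\<close>,
      the middle part \<open>4 * d\<close> and the part below \<open>L\<close> costs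
      \<open>d\<close>.\<close>
    define d where "d = e / (8 * C + 5)"
    have d: "0 < d" "(8 * C + 5) * d = e"
      using \<open>0 < e\<close> C by (auto simp: d_def)
    have "{0<..<1} \<in> pos_intervals"
      unfolding pos_intervals_def by (intro CollectI exI[of _ 0] exI[of _ 1]) simp
    then have int1: "set_integrable lebesgue {0<..<1} (decr_rearr f)"
      by (rule rearr_int[OF f_rearr f_BMO])
    obtain t where t: "L \<le> t" "0 \<le> t" and top: "\<And>g S. S \<in> \<S> \<Longrightarrow> set_integrable lebesgue S g \<Longrightarrow>
        (\<And>x. g x \<le> f x) \<Longrightarrow> mean_osc (\<lambda>x. g x - f x) S \<le> d \<Longrightarrow> mean_osc (\<lambda>x. max (g x - t) 0) S \<le> 4 * d"
      by (rule VMO_truncate_small[OF \<S> f_VMO f_rearr f_nonneg int1 d(1), of L]) blast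
    have lip: "\<bar>max (x - t) 0 - max (y - t) 0\<bar> \<le> \<bar>x - y\<bar>" for x y :: real
      by (auto simp: max_def)
    \<comment> \<open>Applied to \<open>g = F k\<close> and to \<open>g = f\<close>, for which the
      oscillation of the difference is 0.\<close>
    have top_rearr: "set_integrable lebesgue I (\<lambda>s. decr_rearr (\<lambda>x. max (g x - t) 0) s)"
      "mean_osc (decr_rearr (\<lambda>x. max (g x - t) 0)) I \<le> C * (4 * d)"
      if g: "rearrangeable g" "\<And>x. 0 \<le> g x" "\<And>S. S \<in> \<S> \<Longrightarrow> set_integrable lebesgue S g"
        "\<And>x. g x \<le> f x" "\<And>S. S \<in> \<S> \<Longrightarrow> mean_osc (\<lambda>x. g x - f x) S \<le> d"
        and I: "I \<in> pos_intervals" for g I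
    proof -
      have osc: "mean_osc (\<lambda>x. max (g x - t) 0) S \<le> 4 * d" if "S \<in> \<S>" for S
        by (rule top[OF that g(3)[OF that] g(4) g(5)[OF that]])
      have bmo: "(\<lambda>x. max (g x - t) 0) \<in> BMO \<S>"
        by (rule BMO_I[OF set_integrable_lipschitz_comp[OF g(3) S lip] osc])
      have rearr: "rearrangeable (\<lambda>x. max (g x - t) 0)"
        by (rule rearrangeable_truncate[OF g(1,2) t(2)])
      show "set_integrable lebesgue I (\<lambda>s. decr_rearr (\<lambda>x. max (g x - t) 0) s)"
        by (rule rearr_int[OF rearr bmo I])
      show "mean_osc (decr_rearr (\<lambda>x. max (g x - t) 0)) I \<le> C * (4 * d)"
        using d(1) by (intro rearr_osc[OF rearr bmo _ osc I]) auto
    qed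
    have "\<forall>\<^sub>F k in sequentially. \<forall>S\<in>\<S>. mean_osc (\<lambda>x. F k x - f x) S \<le> d"
      using assms(10) d(1) by (simp add: converges_in_BMO_def bmo_seminorm_tendsto_0_iff)
    moreover have "\<forall>\<^sub>F k in sequentially. \<forall>I\<in>pos_intervals. mean_osc (\<lambda>s. max (L - decr_rearr (F k) s) 0) I \<le> d"
      using assms(14) d(1) by (simp add: converges_in_BMO_def bmo_seminorm_tendsto_0_iff)
    moreover have "\<forall>\<^sub>F k in sequentially. \<forall>s>0.
        max L (min t (decr_rearr f s)) - 2 * d \<le> max L (min t (decr_rearr (F k) s))"
    proof (rule clamp_uniform_limit[OF _ _ _ _ t(1) d(1)])
      show "\<forall>\<^sub>F k in sequentially. v < decr_rearr (F k) s" if "0 < s" "L \<le> v" "v < decr_rearr f s" for s v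
        using that \<open>0 \<le> L\<close>
        by (intro decr_rearr_eventually_gt[OF F_rearr f_rearr F_inc F_lim F_nonneg]) auto
      show "\<exists>r>0. a < decr_rearr f r \<and> decr_rearr f r < b"
        if ab: "L < a" "a < b" and s': "0 < s'" "b \<le> decr_rearr f s'" for a b s'
      proof -
        \<comment> \<open>Above the infimum \<open>L\<close> the distribution function of
          \<open>f\<close> is finite; at nonnegative levels below \<open>L\<close> it is
          infinite.\<close>
        obtain s where s: "0 < s" "decr_rearr f s < a"
          using L_less[OF ab(1)] by blast
        have "0 \<le> a" using \<open>0 \<le> L\<close> ab(1) by simp
        obtain r where "0 < r" "a < decr_rearr f r" "decr_rearr f r < b"
          by (rule decr_rearr_no_gap[OF \<S> assms(2) f_VMO f_rearr f_nonneg \<open>0 \<le> a\<close> ab(2) s(1)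
              less_imp_le[OF s(2)] s'])
        then show ?thesis by blast
      qed
    qed (auto intro: decr_rearr_antimono F_rearr f_rearr)
    ultimately show ?thesis
    proof eventually_elim
      case (elim k)
      show ?case
      proof
        fix I
        assume I: "I \<in> pos_intervals"
        let ?F = "decr_rearr (F k)" and ?f = "decr_rearr f"
        define TF where "TF = decr_rearr (\<lambda>x. max (F k x - t) 0)"
        define Tf where "Tf = decr_rearr (\<lambda>x. max (f x - t) 0)"
        define m where "m s = max L (min t (?F s)) - max L (min t (?f s))" for s
        define b where "b s = max (L - ?F s) 0" for s
        have TF: "set_integrable lebesgue I TF" "mean_osc TF I \<le> C * (4 * d)"
          unfolding TF_def using top_rearr[OF F_rearr F_nonneg F_int F_le _ I] elim(1) by auto
        have Tf: "set_integrable lebesgue I Tf" "mean_osc Tf I \<le> C * (4 * d)"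
          unfolding Tf_def using top_rearr[OF f_rearr f_nonneg f_int _ _ I] d(1)
          by (auto simp: mean_osc_def mean_value_def)
        have clamp_lip: "\<bar>max L (min t x) - max L (min t y)\<bar> \<le> \<bar>x - y\<bar>" for x y :: real
          by (auto simp: max_def min_def)
        have m_int: "set_integrable lebesgue I m"
          unfolding m_def
          by (intro set_integral_diff(1) set_integrable_lipschitz_comp[OF rearr_int I_lm clamp_lip]
              F_rearr F_BMO f_rearr f_BMO I)
        \<comment> \<open>The upper bound 0 is monotonicity of rearrangement; the lower one is the
          uniform convergence.\<close>
        have "\<bar>m s\<bar> \<le> 2 * d" if "s \<in> I" for s
        proof -
          have "0 < s" by (rule I_pos[OF I that])
          then have "- (2 * d) \<le> m s" "m s \<le> 0"
            using elim(3) rearr_le[of s k] by (auto simp: m_def algebra_simps max_def min_def)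
          then show ?thesis using d(1) by (simp add: abs_le_iff)
        qed
        then have m: "mean_osc m I \<le> 2 * (2 * d)"
          using d(1) by (intro mean_osc_le_const[OF m_int I_lm[OF I]]) auto
        have b_int: "set_integrable lebesgue I b"
          using assms(14) I unfolding b_def by (auto simp: converges_in_BMO_def BMO_def)
        have b: "mean_osc b I \<le> d"
          using elim(2) I unfolding b_def by blast
        \<comment> \<open>The levels of both functions are split at \<open>t\<close> and
          \<open>L\<close>. Since \<open>?f\<close> stays at or above \<open>L\<close>, only
          \<open>?F\<close> leaves a term \<open>b\<close>.\<close>
        have "mean_osc (\<lambda>s. ?F s - ?f s) I = mean_osc (\<lambda>s. (TF s - Tf s) + (m s - b s)) I"
        proof (rule mean_osc_cong)
          fix s
          assume "s \<in> I"
          then have s: "0 < s" by (rule I_pos[OF I])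
          have "TF s = max (?F s - t) 0" "Tf s = max (?f s - t) 0"
            unfolding TF_def Tf_def
            by (rule decr_rearr_truncate[OF F_rearr F_nonneg t(2) s],
                rule decr_rearr_truncate[OF f_rearr f_nonneg t(2) s])
          then show "?F s - ?f s = (TF s - Tf s) + (m s - b s)"
            using L_le[OF s] t(1) by (auto simp: m_def b_def max_def min_def)
        qed
        also have "\<dots> \<le> mean_osc (\<lambda>s. TF s - Tf s) I + mean_osc (\<lambda>s. m s - b s) I"
          by (intro mean_osc_add_le set_integral_diff(1) TF Tf m_int b_int I_lm I)
        also have "\<dots> \<le> (mean_osc TF I + mean_osc Tf I) + (mean_osc m I + mean_osc b I)"
          by (intro add_mono mean_osc_diff_le TF Tf m_int b_int I_lm I)
        also have "\<dots> \<le> (8 * C + 5) * d"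
          using TF(2) Tf(2) m b by (simp add: algebra_simps)
        finally show "mean_osc (\<lambda>s. ?F s - ?f s) I \<le> e"
          by (simp add: d(2))
      qed
    qed
  qed
  obtain K :: real where K: "0 \<le> K" and transfer:
    "\<And>g B Q. g \<in> borel_measurable borel \<Longrightarrow> (\<And>I. I \<in> pos_intervals \<Longrightarrow> set_integrable lebesgue I g) \<Longrightarrow>
      (\<And>I. I \<in> pos_intervals \<Longrightarrow> mean_osc g I \<le> B) \<Longrightarrow> (Q :: (real ^ 'n) set) \<in> cubes \<Longrightarrow>
      set_integrable lebesgue Q (\<lambda>x. g (radial_vol x)) \<and> mean_osc (\<lambda>x. g (radial_vol x)) Q \<le> K * B"
    by (rule mean_osc_radial_cube_le[where 'n = 'n]) blast
  have symm: "symm_rearr g = (\<lambda>x. decr_rearr g (radial_vol x))" for g :: "real ^ 'n \<Rightarrow> real"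
    by (simp add: fun_eq_iff symm_rearr_def radial_vol_def)
  have symm_BMO: "symm_rearr g \<in> BMO cubes" if g: "rearrangeable g" "g \<in> BMO \<S>" for g :: "real ^ 'n \<Rightarrow> real"
  proof -
    obtain B where B: "0 \<le> B" "\<And>I. I \<in> pos_intervals \<Longrightarrow> mean_osc (decr_rearr g) I \<le> B"
      by (rule BMO_bounded[OF conjunct1[OF c[OF g]]]) blast
    have "set_integrable lebesgue Q (symm_rearr g) \<and> mean_osc (symm_rearr g) Q \<le> K * B"
      if "Q \<in> cubes" for Q :: "(real ^ 'n) set"
      unfolding symm using g B that
      by (intro transfer decr_rearr_borel_measurable rearr_int) auto
    then show ?thesis by (intro BMO_I) auto
  qed
  have "\<forall>\<^sub>F k in sequentially. \<forall>Q\<in>cubes. mean_osc (\<lambda>x. symm_rearr (F k) x - symm_rearr f x) Q \<le> e"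
    if "0 < e" for e
  proof -
    \<comment> \<open>\<open>K\<close> may be 0, so \<open>K + 1\<close> is the divisor.\<close>
    have "0 < e / (K + 1)" "K * (e / (K + 1)) \<le> e"
      using \<open>0 < e\<close> K by (auto simp: field_simps)
    from main[OF this(1)] show ?thesis
    proof eventually_elim
      case (elim k)
      show ?case
      proof
        fix Q :: "(real ^ 'n) set"
        assume "Q \<in> cubes"
        \<comment> \<open>Composition with \<open>radial_vol\<close> is linear, so the transfer
          applies directly to the difference of the two rearrangements.\<close>
        then have "mean_osc (\<lambda>x. symm_rearr (F k) x - symm_rearr f x) Q \<le> K * (e / (K + 1))"
          unfolding symm
          using transfer[of "\<lambda>s. decr_rearr (F k) s - decr_rearr f s" "e / (K + 1)" Q] elim
            rearr_int[OF F_rearr F_BMO] rearr_int[OF f_rearr f_BMO]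
            decr_rearr_borel_measurable[OF F_rearr] decr_rearr_borel_measurable[OF f_rearr]
          by (auto intro: set_integral_diff(1))
        then show "mean_osc (\<lambda>x. symm_rearr (F k) x - symm_rearr f x) Q \<le> e"
          using \<open>K * (e / (K + 1)) \<le> e\<close> by linarith
      qed
    qed
  qed
  then show ?thesis
    unfolding converges_in_BMO_def bmo_seminorm_tendsto_0_iff
    using symm_BMO F_rearr F_BMO f_rearr f_BMO by blast
qed

end
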